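(* Let $0<\alpha<1$. Given $\epsilon>0$ there exists $a=a(\epsilon)>0$ such that for all $n$ sufficiently large and for all $\sigma\in\Omega\setminus\Omega_\epsilon$, $$\mathbb{E}\bigl(h(\sigma_1)-h(\sigma_0)\ \big|\ \sigma_0=\sigma\bigr)\ \ge\ a,$$ where $(\sigma_t)$ is the competitive erosion chain on $\mathrm{Cyl}_n$ and $h(\sigma)=\sum_{(x,y):\,\sigma(x,y)=1}(1-y)$.
   Context: Fix $\alpha\in(0,1)$. For an integer $n\ge 2$ let $C_n=(\frac1n\mathbb{Z})/\mathbb{Z}$, $P_n=(\frac1n\mathbb{Z})\cap[0,1]$, and let $\mathrm{Cyl}_n=C_n\times P_n$ (with $n(n+1)$ vertices $(x,y)$; $y$ is the height), with edges joining $(x,y)$ to $(x\pm\frac1n,y)$ and to $(x,y\pm\frac1n)$ (when the height stays in $[0,1]$), and one self-loop added at each vertex of height $0$ or $1$, so that the graph is $4$-regular (for $n=2$ horizontal edges are doubled). Simple random walk traverses at each step one of the four edges at its current vertex, chosen uniformly. Configurations are maps $\sigma:\mathrm{Cyl}_n\to\{1,2\}$; color $1$ is "blue", color $2$ is "red". $\Omega$ is the set of configurations with exactly $\lfloor\alpha n(n+1)\rfloor$ blue vertices. Competitive erosion is the Markov chain $(\sigma_t)_{t=0,1,2,\dots}$ on $\Omega$ defined as follows. Given $\sigma_t$, start a simple random walk at a uniform vertex of $C_n\times\{0\}$, run it to the first visited vertex (time $0$ included) that is red in $\sigma_t$, and recolor that vertex blue; this gives $\sigma_{t+1/2}$. Then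 start an independent simple random walk at a uniform vertex of $C_n\times\{1\}$, run it to the first visited vertex (time $0$ included) that is blue in $\sigma_{t+1/2}$, and recolor that vertex red; this gives $\sigma_{t+1}$. All walks are independent. $\Omega_\epsilon$ is the set of $\sigma\in\Omega$ such that both $$\#\{y\in P_n:\ y\le\alpha,\ \sigma(j,y)=2\text{ for some }j\in C_n\}\le\epsilon n$$ and $$\#\{y\in P_n:\ y\ge\alpha,\ \sigma(j,y)=1\text{ for some }j\in C_n\}\le\epsilon n.$$ *)

theory Defs
  imports "HOL-Probability.Probability"
begin

text \<open>The vertex \<open>(i, j)\<close> with \<open>i < n\<close>, \<open>j \<le> n\<close> stands for the point \<open>(i/n mod 1, j/n)\<close>
  of \<open>C\<^sub>n \<times> P\<^sub>n\<close>.\<close>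

type_synonym vertex = "nat \<times> nat"

definition cyl :: "nat \<Rightarrow> vertex set" where
  "cyl n = {..<n} \<times> {..n}"

definition height :: "nat \<Rightarrow> nat \<Rightarrow> real" where
  "height n j = real j / real n"

text \<open>The four edges at a vertex are labelled by directions.  The self-loops are the downward edge
  at height 0 and the upward edge at height 1; for \<open>n = 2\<close> the two horizontal edges lead to the
  same neighbour, so they are doubled.\<close>

datatype direction = East | West | North | South

fun move :: "nat \<Rightarrow> direction \<Rightarrow> vertex \<Rightarrow> vertex" where
  "move n East (i, j) = ((i + 1) mod n, j)"
| "move n West (i, j) = ((i + (n - 1)) mod n, j)"
| "move n North (i, j) = (i, if j < n then j + 1 else j)"
| "move n South (i, j) = (i, if j > 0 then j - 1 else j)"

primrec walk :: "nat \<Rightarrow> vertex \<times> (nat \<Rightarrow> direction) \<Rightarrow> nat \<Rightarrow> vertex" where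
  "walk n w 0 = fst w"
| "walk n w (Suc t) = move n (snd w t) (walk n w t)"

text \<open>Law of the pair (uniform starting vertex on the circle with index \<open>j\<close>, i.i.d. uniform
  directions) driving one simple random walk.\<close>

definition walk_space :: "nat \<Rightarrow> nat \<Rightarrow> (vertex \<times> (nat \<Rightarrow> direction)) measure" where
  "walk_space n j =
     measure_pmf (pmf_of_set ({..<n} \<times> {j})) \<Otimes>\<^sub>M
     (\<Pi>\<^sub>M t\<in>(UNIV :: nat set). measure_pmf (pmf_of_set {East, West, North, South}))"

text \<open>If the walk never visits \<open>A\<close> (a null event for nonempty \<open>A \<subseteq> cyl n\<close>), the value is
  unspecified.\<close>

definition first_visited :: "nat \<Rightarrow> vertex set \<Rightarrow> vertex \<times> (nat \<Rightarrow> direction) \<Rightarrow> vertex" where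
  "first_visited n A w = walk n w (LEAST t. walk n w t \<in> A)"

datatype colour = Blue | Red

type_synonym config = "vertex \<Rightarrow> colour"

definition coloured :: "nat \<Rightarrow> config \<Rightarrow> colour \<Rightarrow> vertex set" where
  "coloured n \<sigma> c = {v \<in> cyl n. \<sigma> v = c}"

definition Omega :: "real \<Rightarrow> nat \<Rightarrow> config set" where
  "Omega \<alpha> n = {\<sigma> \<in> cyl n \<rightarrow>\<^sub>E UNIV.
     int (card (coloured n \<sigma> Blue)) = \<lfloor>\<alpha> * real n * (real n + 1)\<rfloor>}"

definition Omega_eps :: "real \<Rightarrow> real \<Rightarrow> nat \<Rightarrow> config set" where
  "Omega_eps \<alpha> \<epsilon> n = {\<sigma> \<in> Omega \<alpha> n.
     real (card {j \<in> {..n}. height n j \<le> \<alpha> \<and> (\<exists>i<n. \<sigma> (i, j) = Red)}) \<le> \<epsilon> * real n \<and>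
     real (card {j \<in> {..n}. height n j \<ge> \<alpha> \<and> (\<exists>i<n. \<sigma> (i, j) = Blue)}) \<le> \<epsilon> * real n}"

definition blue_step :: "nat \<Rightarrow> config \<Rightarrow> vertex \<times> (nat \<Rightarrow> direction) \<Rightarrow> config" where
  "blue_step n \<sigma> w = \<sigma>(first_visited n (coloured n \<sigma> Red) w := Blue)"

definition red_step :: "nat \<Rightarrow> config \<Rightarrow> vertex \<times> (nat \<Rightarrow> direction) \<Rightarrow> config" where
  "red_step n \<sigma> w = \<sigma>(first_visited n (coloured n \<sigma> Blue) w := Red)"

text \<open>The noise at time \<open>t\<close> is a pair of independent walks, from height 0 and from height 1;
  different times are independent.\<close>

type_synonym noise = "(vertex \<times> (nat \<Rightarrow> direction)) \<times> (vertex \<times> (nat \<Rightarrow> direction))"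

definition erosion_space :: "nat \<Rightarrow> (nat \<Rightarrow> noise) measure" where
  "erosion_space n = (\<Pi>\<^sub>M t\<in>(UNIV :: nat set). walk_space n 0 \<Otimes>\<^sub>M walk_space n n)"

text \<open>\<open>erosion n \<sigma> t\<close>, a random variable on \<open>erosion_space n\<close>, is the state at time \<open>t\<close> of the
  chain started from \<open>\<sigma>\<close>.\<close>

primrec erosion :: "nat \<Rightarrow> config \<Rightarrow> nat \<Rightarrow> (nat \<Rightarrow> noise) \<Rightarrow> config" where
  "erosion n \<sigma> 0 \<omega> = \<sigma>"
| "erosion n \<sigma> (Suc t) \<omega> =
     red_step n (blue_step n (erosion n \<sigma> t \<omega>) (fst (\<omega> t))) (snd (\<omega> t))"

definition h :: "nat \<Rightarrow> config \<Rightarrow> real" where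
  "h n \<sigma> = (\<Sum>(i, j)\<in>coloured n \<sigma> Blue. 1 - height n j)"

end

theory Submission
  imports Defs
begin

text \<open>
  Let \<open>Z\<close> and \<open>W\<close> be the vertices recoloured blue and red, so that the drift is
  \<open>E (y\<^sub>W - y\<^sub>Z)\<close>.  Absorbing the blue walk also at height 1 only increases its exit height; the
  expected exit height of this walk, as a function \<open>u\<close> of the starting point, is harmonic off the
  absorbing set, and \<open>g = u - y\<close> vanishes on that set and has source \<open>1/n\<close> at each bottom vertex.
  Hence its mean \<open>M\<close> over the bottom row, which bounds \<open>E y\<^sub>Z\<close>, equals its Dirichlet energy.  On the
  other hand \<open>n M\<close> is the sum of the drops of \<open>g\<close> along vertical edges, and only edges with a blue
  lower end contribute positively.  By AM-GM, \<open>M\<close> plus the horizontal energy is at most the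
  number of blue vertices over \<open>n\<^sup>2\<close>.  By reflection \<open>E (1 - y\<^sub>W)\<close> obeys the same bound with red
  vertices, and the two bounds add up to \<open>1 + 1/n\<close>.

  A gain comes from rows of height at most \<open>\<alpha>\<close> containing a red vertex, where \<open>g\<close> vanishes.
  If there are more than \<open>\<epsilon> n\<close> of them, then either \<open>g\<close> is uniformly small on one at height at most
  \<open>\<alpha> - \<epsilon>/2\<close>, and the same estimate below that row makes \<open>M\<close> smaller than \<open>\<alpha>\<close> by a constant, or
  all these rows have a large oscillation and the horizontal energy is bounded below.  The
  other half of the definition of \<open>\<Omega>\<^sub>\<epsilon>\<close> is treated by reflection.
\<close>

section \<open>The averaging operator and its Dirichlet problem\<close>

text \<open>Transition operator of the walk frozen on A. Its T-th iterate gives the expectation of f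
  at the position after T steps of the walk frozen on entering A (\<open>integral_stopped\<close>),
  so the exit heights can be estimated by pure potential theory.\<close>

definition step_avg :: "nat \<Rightarrow> vertex set \<Rightarrow> (vertex \<Rightarrow> real) \<Rightarrow> vertex \<Rightarrow> real" where
  "step_avg n A f v =
     (if v \<in> A then f v
      else (f (move n East v) + f (move n West v) + f (move n North v) + f (move n South v)) / 4)"

section \<open>Cyclic sums, summation by parts and the energy of a row\<close>

lemma move_in_cyl: "v \<in> cyl n \<Longrightarrow> move n d v \<in> cyl n"
  by (cases v; cases d) (auto simp: cyl_def)

lemma finite_cyl [simp]: "finite (cyl n)"
  by (simp add: cyl_def)

lemma sum_cyclic_shift:
  fixes \<phi> :: "nat \<Rightarrow> 'a::comm_monoid_add"
  assumes "n \<ge> 1"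
  shows "(\<Sum>i<n. \<phi> ((i + 1) mod n)) = (\<Sum>i<n. \<phi> i)"
proof -
  obtain m where m: "n = Suc m" using assms by (cases n) auto
  have "(\<Sum>i<m. \<phi> ((i + 1) mod n)) = (\<Sum>i<m. \<phi> (Suc i))"
    using m by (intro sum.cong) auto
  moreover have "\<phi> ((m + 1) mod n) = \<phi> 0"
    using m by simp
  ultimately show ?thesis
    unfolding m by (simp only: sum.lessThan_Suc) (metis sum.lessThan_Suc sum.lessThan_Suc_shift add.commute)
qed

lemma cyclic_pred_succ:
  fixes i n :: nat
  assumes "i < n"
  shows "((i + 1) mod n + (n - 1)) mod n = i"
  using assms by (cases "Suc i = n") auto

text \<open>Summation by parts on the cycle: a cyclic shift turns the cross term with the
  predecessor into the one with the successor, and leaves the sum of squares unchanged.\<close>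

lemma horizontal_energy:
  fixes f :: "nat \<Rightarrow> real"
  assumes "n \<ge> 1"
  shows "(\<Sum>i<n. f i * (2 * f i - f ((i + 1) mod n) - f ((i + (n - 1)) mod n)))
    = (\<Sum>i<n. (f ((i + 1) mod n) - f i)\<^sup>2)"
proof -
  have 1: "(\<Sum>i<n. f i * f ((i + (n - 1)) mod n)) = (\<Sum>i<n. f ((i + 1) mod n) * f i)"
    by (subst sum_cyclic_shift[OF assms, symmetric])
      (intro sum.cong refl, simp only: lessThan_iff cyclic_pred_succ)
  have 2: "(\<Sum>i<n. (f ((i + 1) mod n))\<^sup>2) = (\<Sum>i<n. (f i)\<^sup>2)"
    by (rule sum_cyclic_shift[OF assms, of "\<lambda>i. (f i)\<^sup>2"])
  show ?thesis
    using 1 2 by (simp add: power2_diff algebra_simps sum.distrib sum_subtractf sum_distrib_left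
        power2_eq_square sum_distrib_right)
qed

text \<open>Summation by parts on a column. Truncated subtraction makes j - 1 equal to 0 at j = 0,
  which is exactly the self-loop at the bottom; the boundary term at the upper end vanishes for
  functions that are 0 there.\<close>

lemma vertical_energy:
  fixes f :: "nat \<Rightarrow> real"
  shows "(\<Sum>j<Suc m. f j * (2 * f j - f (j + 1) - f (j - 1)))
    = (\<Sum>j<Suc m. (f j - f (j + 1))\<^sup>2) + f (Suc m) * (f m - f (Suc m))"
  by (induction m) (simp_all add: power2_eq_square algebra_simps)

text \<open>Walking along the row from the zero to the large value forces total variation at least
  \<delta>; Cauchy-Schwarz over the n edges turns this into energy.\<close>

lemma exists_jump_energy:
  fixes f :: "nat \<Rightarrow> real" and \<delta> :: real
  assumes "a < n" "b < n" "f a = 0" "f b > \<delta>" "\<delta> \<ge> 0"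
  shows "(\<Sum>i<n. (f ((i + 1) mod n) - f i)\<^sup>2) \<ge> \<delta>\<^sup>2 / n"
proof -
  let ?K = "\<lambda>i. f ((i + 1) mod n) - f i"
  have tel: "\<bar>f q - f p\<bar> \<le> (\<Sum>i<n. \<bar>?K i\<bar>)" if "p \<le> q" "q < n" for p q
  proof -
    have "f q - f p = (\<Sum>i=p..<q. f (Suc i) - f i)"
      using that by (simp add: sum_Suc_diff')
    also have "\<dots> = (\<Sum>i=p..<q. ?K i)"
      using that by (intro sum.cong) auto
    finally have "\<bar>f q - f p\<bar> \<le> (\<Sum>i=p..<q. \<bar>?K i\<bar>)"
      by (simp add: sum_abs)
    also have "\<dots> \<le> (\<Sum>i<n. \<bar>?K i\<bar>)"
      using that by (intro sum_mono2) auto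
    finally show ?thesis .
  qed
  have "\<delta> \<le> (\<Sum>i<n. \<bar>?K i\<bar>)"
    using tel[of a b] tel[of b a] assms by (cases "a \<le> b") auto
  then have "\<delta>\<^sup>2 \<le> (\<Sum>i<n. \<bar>?K i\<bar>)\<^sup>2"
    using assms by (intro power_mono) auto
  also have "\<dots> \<le> (\<Sum>i<n. (?K i)\<^sup>2) * n"
    using Cauchy_Schwarz_ineq_sum[of "\<lambda>i. \<bar>?K i\<bar>" "\<lambda>_. 1" "{..<n}"] by simp
  finally show ?thesis
    using assms by (simp add: divide_le_eq)
qed

section \<open>Energy bounds for the Green function with source on the bottom row\<close>

text \<open>Dividing \<open>poisson\<close> by 4 shows that g(v) is 1/(4n) times the expected number
  of visits to the bottom row, started at v and killed on A.\<close>

locale bottom_green =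
  fixes n :: nat and A :: "vertex set" and g :: "vertex \<Rightarrow> real"
  assumes n: "n \<ge> 1"
    and top: "\<And>i. i < n \<Longrightarrow> (i, n) \<in> A"
    and zero: "\<And>v. v \<in> cyl n \<Longrightarrow> v \<in> A \<Longrightarrow> g v = 0"
    and nonneg: "\<And>v. v \<in> cyl n \<Longrightarrow> g v \<ge> 0"
    and poisson: "\<And>i j. (i, j) \<in> cyl n \<Longrightarrow> (i, j) \<notin> A \<Longrightarrow>
      4 * g (i, j) = g (move n East (i, j)) + g (move n West (i, j)) + g (move n North (i, j))
        + g (move n South (i, j)) + (if j = 0 then 1 / n else 0)"
begin

definition mass :: real where "mass = (\<Sum>i<n. g (i, 0)) / n"

definition row_energy :: "nat \<Rightarrow> real" where
  "row_energy j = (\<Sum>i<n. (g ((i + 1) mod n, j) - g (i, j))\<^sup>2)"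

text \<open>Multiply the Poisson equation by g and sum by parts. On A, where the equation may fail,
  the factor g vanishes; rows j < n suffice because g is 0 on the top row. The source 1/n pairs with
  g to give \<open>mass\<close>.\<close>

lemma energy_identity:
  "mass = (\<Sum>i<n. \<Sum>j<n. (g (i, j) - g (i, j + 1))\<^sup>2) + (\<Sum>j<n. row_energy j)"
proof -
  have pt: "g (i, j) * (2 * g (i, j) - g (i, j + 1) - g (i, j - 1))
     + g (i, j) * (2 * g (i, j) - g ((i + 1) mod n, j) - g ((i + (n - 1)) mod n, j))
     = (if j = 0 then g (i, j) / n else 0)" if "i < n" "j < n" for i j
  proof (cases "(i, j) \<in> A")
    case True
    then show ?thesis using zero[of "(i, j)"] that by (auto simp: cyl_def)
  next
    case False
    have "(2 * g (i, j) - g (i, j + 1) - g (i, j - 1))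
       + (2 * g (i, j) - g ((i + 1) mod n, j) - g ((i + (n - 1)) mod n, j))
       = (if j = 0 then 1 / n else 0)"
      using poisson[of i j] False that by (cases "j = 0") (auto simp: cyl_def)
    then show ?thesis
      by (simp only: distrib_left[symmetric]) auto
  qed
  have "mass = (\<Sum>i<n. \<Sum>j<n. if j = 0 then g (i, j) / n else 0)"
    using n by (simp add: mass_def sum.If_cases sum_divide_distrib)
  also have "\<dots> = (\<Sum>i<n. \<Sum>j<n. g (i, j) * (2 * g (i, j) - g (i, j + 1) - g (i, j - 1)))
     + (\<Sum>i<n. \<Sum>j<n. g (i, j) * (2 * g (i, j) - g ((i + 1) mod n, j) - g ((i + (n - 1)) mod n, j)))"
    unfolding sum.distrib[symmetric] using pt by (intro sum.cong refl) simp
  also have "(\<Sum>i<n. \<Sum>j<n. g (i, j) * (2 * g (i, j) - g (i, j + 1) - g (i, j - 1)))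
      = (\<Sum>i<n. \<Sum>j<n. (g (i, j) - g (i, j + 1))\<^sup>2)"
  proof (rule sum.cong[OF refl])
    fix i assume "i \<in> {..<n}"
    then have "g (i, n) = 0" using zero[of "(i, n)"] top by (auto simp: cyl_def)
    then show "(\<Sum>j<n. g (i, j) * (2 * g (i, j) - g (i, j + 1) - g (i, j - 1)))
      = (\<Sum>j<n. (g (i, j) - g (i, j + 1))\<^sup>2)"
      using vertical_energy[of "\<lambda>j. g (i, j)" "n - 1"] n by simp
  qed
  also have "(\<Sum>i<n. \<Sum>j<n. g (i, j) * (2 * g (i, j) - g ((i + 1) mod n, j) - g ((i + (n - 1)) mod n, j)))
      = (\<Sum>j<n. row_energy j)"
    unfolding row_energy_def
    by (subst sum.swap) (intro sum.cong refl horizontal_energy[OF n])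
  finally show ?thesis .
qed

text \<open>The drop of \<open>g\<close> along a vertical edge is at most 0 when the lower end lies in \<open>A\<close>; on the
  other edges, AM-GM bounds a drop \<open>x\<close> by \<open>(n x\<^sup>2 + 1/n) / 2\<close>.\<close>

lemma mass_bound:
  assumes k: "k \<le> n"
  shows "mass + (\<Sum>j<n. row_energy j)
    \<le> 2 * (\<Sum>i<n. g (i, k)) / n + card {v \<in> {..<n} \<times> {..<k}. v \<notin> A} / (real n)\<^sup>2"
proof -
  define W where "W = {v \<in> {..<n} \<times> {..<k}. v \<notin> A}"
  define V where "V = (\<lambda>v. g v - g (fst v, snd v + 1))"
  have finW: "finite W" by (simp add: W_def)
  have "real n * mass = (\<Sum>i<n. g (i, 0))"
    using n by (simp add: mass_def)
  also have "\<dots> = (\<Sum>i<n. g (i, k)) + (\<Sum>i<n. \<Sum>j<k. g (i, j) - g (i, Suc j))"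
    unfolding sum.distrib[symmetric] by (intro sum.cong refl) (simp add: sum_lessThan_telescope'[of "\<lambda>j. g (_, j)"])
  also have "(\<Sum>i<n. \<Sum>j<k. g (i, j) - g (i, Suc j)) = (\<Sum>v\<in>{..<n} \<times> {..<k}. V v)"
    by (simp add: sum.cartesian_product V_def split_def)
  also have "(\<Sum>v\<in>{..<n} \<times> {..<k}. V v) \<le> (\<Sum>v\<in>W. V v)"
  proof -
    have "(\<Sum>v\<in>{..<n} \<times> {..<k}. V v) = (\<Sum>v\<in>W. V v) + (\<Sum>v\<in>{..<n} \<times> {..<k} - W. V v)"
      by (subst add.commute, rule sum.subset_diff) (auto simp: W_def)
    moreover have "(\<Sum>v\<in>{..<n} \<times> {..<k} - W. V v) \<le> 0"
    proof (rule sum_nonpos)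
      fix v assume v: "v \<in> {..<n} \<times> {..<k} - W"
      then have "g v = 0" using zero[of v] k by (auto simp: W_def cyl_def)
      moreover have "g (fst v, snd v + 1) \<ge> 0" using v k by (intro nonneg) (auto simp: cyl_def)
      ultimately show "V v \<le> 0" by (simp add: V_def)
    qed
    ultimately show ?thesis by simp
  qed
  also have "(\<Sum>v\<in>W. V v) \<le> (\<Sum>v\<in>W. (n * (V v)\<^sup>2 + 1 / n) / 2)"
  proof (rule sum_mono)
    fix v
    have "0 \<le> (n * V v - 1)\<^sup>2 / n" by simp
    also have "\<dots> = n * (V v)\<^sup>2 + 1 / n - 2 * V v"
      using n by (simp add: power2_eq_square field_simps)
    finally show "V v \<le> (n * (V v)\<^sup>2 + 1 / n) / 2" by simp
  qed
  also have "\<dots> = n / 2 * (\<Sum>v\<in>W. (V v)\<^sup>2) + card W / (2 * n)"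
    by (simp add: sum.distrib sum_divide_distrib[symmetric] sum_distrib_left add_divide_distrib)
  also have "(\<Sum>v\<in>W. (V v)\<^sup>2) \<le> (\<Sum>v\<in>{..<n} \<times> {..<n}. (V v)\<^sup>2)"
    using k by (intro sum_mono2) (auto simp: W_def)
  \<comment> \<open>By the energy identity, half of the mass reappears on the right. Moving it to
    the left doubles the remaining terms, whence the factor 2 in front of the row sum.\<close>
  also have "(\<Sum>v\<in>{..<n} \<times> {..<n}. (V v)\<^sup>2) = mass - (\<Sum>j<n. row_energy j)"
    by (subst energy_identity) (simp add: sum.cartesian_product V_def split_def)
  finally have main: "n * mass \<le> (\<Sum>i<n. g (i, k))
     + (n / 2 * (mass - (\<Sum>j<n. row_energy j)) + card W / (2 * n))"
    using n by simp
  define S R where "S = (\<Sum>i<n. g (i, k))" and "R = (\<Sum>j<n. row_energy j)"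
  have "n * (mass + R) \<le> 2 * S + card W / n"
    using main unfolding S_def[symmetric] R_def[symmetric] by (simp add: field_simps)
  then have "mass + R \<le> (2 * S + card W / n) / n"
    using n by (simp add: pos_le_divide_eq mult.commute)
  then show ?thesis
    by (simp add: S_def R_def W_def add_divide_distrib power2_eq_square)
qed

text \<open>Dichotomy. If g \<le> \<delta> on a whole row j of J, \<open>mass_bound\<close> with k =
  j counts at most n j vertices and gives j/n + 2\<delta>. Otherwise every row of J carries both a
  zero of g, at a vertex of A, and a value above \<delta>, so it contributes \<delta>^2/n to the
  horizontal energy, and k = n applies.\<close>

lemma mass_bound_rows:
  fixes \<kappa> \<delta> :: real
  assumes J: "J \<subseteq> {..n}" "\<And>j. j \<in> J \<Longrightarrow> \<exists>i<n. (i, j) \<in> A" "\<And>j. j \<in> J \<Longrightarrow> real j \<le> \<kappa> * n"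
    and \<delta>: "\<delta> \<ge> 0"
  shows "mass \<le> max (\<kappa> + 2 * \<delta>) (card (cyl n - A) / (real n)\<^sup>2 - card J * \<delta>\<^sup>2 / n)"
proof (cases "\<exists>j\<in>J. \<forall>i<n. g (i, j) \<le> \<delta>")
  case True
  then obtain j where j: "j \<in> J" "\<And>i. i < n \<Longrightarrow> g (i, j) \<le> \<delta>" by auto
  have jn: "j \<le> n" using j J by auto
  have "0 \<le> (\<Sum>j<n. row_energy j)" by (simp add: row_energy_def sum_nonneg)
  then have "mass \<le> 2 * (\<Sum>i<n. g (i, j)) / n + card {v \<in> {..<n} \<times> {..<j}. v \<notin> A} / (real n)\<^sup>2"
    using mass_bound[OF jn] by linarith
  also have "(\<Sum>i<n. g (i, j)) \<le> (\<Sum>i<n. \<delta>)" using j by (intro sum_mono) auto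
  also have "real (card {v \<in> {..<n} \<times> {..<j}. v \<notin> A}) \<le> card ({..<n} \<times> {..<j})"
    by (intro of_nat_mono card_mono) auto
  also have "2 * (\<Sum>i<n. \<delta>) / n + card ({..<n} \<times> {..<j}) / (real n)\<^sup>2 = 2 * \<delta> + j / n"
    using n by (simp add: power2_eq_square)
  also have "j / n \<le> \<kappa>" using J(3)[OF j(1)] n by (simp add: divide_le_eq)
  finally show ?thesis by (simp add: divide_right_mono)
next
  case False
  \<comment> \<open>Row n lies in A, so g = 0 \<le> \<delta> there and this row would belong to the
    first case; the energy sum covers only rows below n.\<close>
  have Jn: "J \<subseteq> {..<n}"
  proof
    fix j assume "j \<in> J"
    moreover have "j \<noteq> n"
    proof
      assume "j = n"
      then have "\<forall>i<n. g (i, j) \<le> \<delta>" using zero top \<delta> by (auto simp: cyl_def)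
      then show False using False \<open>j \<in> J\<close> by auto
    qed
    ultimately show "j \<in> {..<n}" using J by force
  qed
  have "card J * \<delta>\<^sup>2 / n = (\<Sum>j\<in>J. \<delta>\<^sup>2 / n)" by simp
  also have "\<dots> \<le> (\<Sum>j\<in>J. row_energy j)"
  proof (rule sum_mono)
    fix j assume j: "j \<in> J"
    obtain a where a: "a < n" "(a, j) \<in> A" using J(2)[OF j] by auto
    obtain b where b: "b < n" "g (b, j) > \<delta>" using False j by force
    have "g (a, j) = 0" using a j J by (intro zero) (auto simp: cyl_def)
    then show "\<delta>\<^sup>2 / n \<le> row_energy j"
      unfolding row_energy_def using exists_jump_energy[of a n b "\<lambda>i. g (i, j)" \<delta>] a b \<delta> by simp
  qed
  also have "\<dots> \<le> (\<Sum>j<n. row_energy j)"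
    using Jn by (intro sum_mono2) (auto simp: row_energy_def sum_nonneg)
  finally have 1: "card J * \<delta>\<^sup>2 / n \<le> (\<Sum>j<n. row_energy j)" .
  have 2: "(\<Sum>i<n. g (i, n)) = 0" using zero top by (intro sum.neutral) (auto simp: cyl_def)
  have "{v \<in> {..<n} \<times> {..<n}. v \<notin> A} \<subseteq> cyl n - A" by (auto simp: cyl_def)
  then have "card {v \<in> {..<n} \<times> {..<n}. v \<notin> A} / (real n)\<^sup>2 \<le> card (cyl n - A) / (real n)\<^sup>2"
    by (intro divide_right_mono of_nat_mono card_mono) auto
  then have "mass \<le> card (cyl n - A) / (real n)\<^sup>2 - card J * \<delta>\<^sup>2 / n"
    using 1 2 mass_bound[of n] by simp
  then show ?thesis by simp
qed

end

section \<open>Expected exit heights of absorbed walks\<close>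

lemma step_avg_mono:
  assumes "\<And>v. v \<in> cyl n \<Longrightarrow> f v \<le> f' v" "v \<in> cyl n"
  shows "step_avg n A f v \<le> step_avg n A f' v"
  unfolding step_avg_def using assms(2)
  by (auto intro!: divide_right_mono add_mono assms(1) move_in_cyl simp del: move.simps)

lemma funpow_step_avg_mono:
  assumes "\<And>v. v \<in> cyl n \<Longrightarrow> f v \<le> f' v" "v \<in> cyl n"
  shows "(step_avg n A ^^ T) f v \<le> (step_avg n A ^^ T) f' v"
  using assms(2) by (induction T arbitrary: v) (auto intro: assms(1) step_avg_mono)

lemma step_avg_const: "step_avg n A (\<lambda>_. c) = (\<lambda>_. c)"
  by (auto simp: step_avg_def)

lemma funpow_step_avg_const: "(step_avg n A ^^ T) (\<lambda>_. c) = (\<lambda>_. c)"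
  by (induction T) (simp_all add: step_avg_const)

lemma exit_height_bound:
  fixes \<kappa> \<delta> :: real
  assumes n: "n \<ge> 1" and top: "\<And>i. i < n \<Longrightarrow> (i, n) \<in> A"
    and J: "J \<subseteq> {..n}" "\<And>j. j \<in> J \<Longrightarrow> \<exists>i<n. (i, j) \<in> A" "\<And>j. j \<in> J \<Longrightarrow> real j \<le> \<kappa> * n"
    and \<delta>: "\<delta> \<ge> 0"
  shows "(\<Sum>i<n. (step_avg n A ^^ T) (height n \<circ> snd) (i, 0)) / n
    \<le> max (\<kappa> + 2 * \<delta>) (card (cyl n - A) / (real n)\<^sup>2 - card J * \<delta>\<^sup>2 / n)"
proof -
  define F where "F = (\<lambda>T. (step_avg n A ^^ T) (height n \<circ> snd))"
  have FSuc: "F (Suc T) = step_avg n A (F T)" for T by (simp add: F_def)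
  \<comment> \<open>The self-loop at the bottom replaces a step down to height -1/n, hence the
    excess 1/(4n). The opposite defect at height 1 cannot occur, since the top row is in A.\<close>
  have height_step: "step_avg n A (height n \<circ> snd) (i, j)
      = height n j + (if (i, j) \<notin> A \<and> j = 0 then 1 / (4 * n) else 0)"
    if "(i, j) \<in> cyl n" for i j
  proof (cases "(i, j) \<in> A")
    case False
    then have "j < n" using that top[of i] by (auto simp: cyl_def le_less)
    with False show ?thesis
      using n by (cases "j = 0") (auto simp: step_avg_def height_def field_simps of_nat_diff)
  qed (simp add: step_avg_def)
  have mono_base: "(height n \<circ> snd) v \<le> step_avg n A (height n \<circ> snd) v" if "v \<in> cyl n" for v
    using height_step[of "fst v" "snd v"] that by simp
  have inc: "F T v \<le> F (Suc T) v" if "v \<in> cyl n" for T v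
  proof -
    have "F (Suc T) v = (step_avg n A ^^ T) (step_avg n A (height n \<circ> snd)) v"
      by (simp only: F_def funpow_swap1 funpow.simps o_apply)
    moreover have "(step_avg n A ^^ T) (height n \<circ> snd) v
        \<le> (step_avg n A ^^ T) (step_avg n A (height n \<circ> snd)) v"
      by (rule funpow_step_avg_mono[OF mono_base that])
    ultimately show ?thesis by (simp add: F_def)
  qed
  have F1: "F T v \<le> 1" if "v \<in> cyl n" for T v
    using funpow_step_avg_mono[of n "height n \<circ> snd" "\<lambda>_. 1" v T A] that n
    by (auto simp: F_def funpow_step_avg_const cyl_def height_def)
  have "\<exists>l. (\<lambda>T. F T v) \<longlonglongrightarrow> l \<and> (\<forall>T. F T v \<le> l)" if v: "v \<in> cyl n" for v
  proof -
    have "incseq (\<lambda>T. F T v)" by (rule incseq_SucI) (rule inc[OF v])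
    then obtain l where "(\<lambda>T. F T v) \<longlonglongrightarrow> l" "\<forall>T. F T v \<le> l"
      by (rule incseq_convergent[of _ 1]) (use F1[OF v] in auto)
    then show ?thesis by blast
  qed
  then obtain u where u: "\<And>v. v \<in> cyl n \<Longrightarrow> (\<lambda>T. F T v) \<longlonglongrightarrow> u v"
    and Fu: "\<And>v T. v \<in> cyl n \<Longrightarrow> F T v \<le> u v"
    by metis
  have stepu: "step_avg n A u v = u v" if v: "v \<in> cyl n" for v
  proof -
    have "(\<lambda>T. step_avg n A (F T) v) \<longlonglongrightarrow> step_avg n A u v"
      unfolding step_avg_def using v by (auto intro!: tendsto_intros u move_in_cyl)
    moreover have "(\<lambda>T. F (Suc T) v) \<longlonglongrightarrow> u v"
      by (rule LIMSEQ_Suc[OF u[OF v]])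
    ultimately show ?thesis unfolding FSuc using LIMSEQ_unique by blast
  qed
  have FA: "F T v = height n (snd v)" if "v \<in> A" for T v
    by (induction T) (use that in \<open>simp_all add: F_def step_avg_def\<close>)
  define g where "g = (\<lambda>v. u v - height n (snd v))"
  interpret bottom_green n A g
  proof
    show "g v = 0" if "v \<in> cyl n" "v \<in> A" for v
      using u[OF that(1)] FA[OF that(2)] LIMSEQ_unique[OF _ tendsto_const] by (auto simp: g_def)
    show "g v \<ge> 0" if "v \<in> cyl n" for v
      using Fu[OF that, of 0] by (simp add: g_def F_def)
    fix i j assume ij: "(i, j) \<in> cyl n" "(i, j) \<notin> A"
    show "4 * g (i, j) = g (move n East (i, j)) + g (move n West (i, j)) + g (move n North (i, j))
        + g (move n South (i, j)) + (if j = 0 then 1 / n else 0)"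
      using stepu[OF ij(1)] height_step[OF ij(1)] ij n
      by (cases "j = 0") (auto simp: step_avg_def g_def field_simps)
  qed (use n top in auto)
  \<comment> \<open>The height is 0 on the bottom row, so g and u agree there.\<close>
  have "(\<Sum>i<n. F T (i, 0)) / n \<le> mass"
    unfolding mass_def using Fu by (intro divide_right_mono sum_mono) (auto simp: g_def height_def cyl_def)
  also have "\<dots> \<le> max (\<kappa> + 2 * \<delta>) (card (cyl n - A) / (real n)\<^sup>2 - card J * \<delta>\<^sup>2 / n)"
    by (rule mass_bound_rows[OF J \<delta>])
  finally show ?thesis by (simp add: F_def)
qed

section \<open>Reflection exchanging bottom and top\<close>

definition refl_height :: "nat \<Rightarrow> vertex \<Rightarrow> vertex" where
  "refl_height n v = (fst v, n - snd v)"

lemma refl_height_in_cyl [simp]: "v \<in> cyl n \<Longrightarrow> refl_height n v \<in> cyl n"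
  by (auto simp: cyl_def refl_height_def)

lemma refl_height_refl_height [simp]: "v \<in> cyl n \<Longrightarrow> refl_height n (refl_height n v) = v"
  by (auto simp: cyl_def refl_height_def)

text \<open>The reflection is a graph automorphism that swaps North and South, self-loops included.
  Because of truncated subtraction it is an involution only on \<open>cyl n\<close>.\<close>

lemma step_avg_refl_height:
  assumes "v \<in> cyl n"
  shows "step_avg n {v. refl_height n v \<in> A} (\<lambda>v. f (refl_height n v)) v = step_avg n A f (refl_height n v)"
proof -
  obtain i j where v: "v = (i, j)" by force
  have "refl_height n (move n North v) = move n South (refl_height n v)"
    "refl_height n (move n South v) = move n North (refl_height n v)"
    "refl_height n (move n East v) = move n East (refl_height n v)"
    "refl_height n (move n West v) = move n West (refl_height n v)"
    using assms by (auto simp: v cyl_def refl_height_def)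
  then show ?thesis by (simp add: step_avg_def)
qed

lemma step_avg_cong:
  assumes "\<And>v. v \<in> cyl n \<Longrightarrow> f v = f' v" "v \<in> cyl n"
  shows "step_avg n A f v = step_avg n A f' v"
  using assms by (intro antisym step_avg_mono) auto

lemma funpow_step_avg_refl_height:
  assumes "v \<in> cyl n"
  shows "(step_avg n {v. refl_height n v \<in> A} ^^ T) (\<lambda>v. f (refl_height n v)) v
    = (step_avg n A ^^ T) f (refl_height n v)"
  using assms
proof (induction T arbitrary: v)
  case (Suc T)
  have "step_avg n {v. refl_height n v \<in> A}
      ((step_avg n {v. refl_height n v \<in> A} ^^ T) (\<lambda>v. f (refl_height n v))) v
    = step_avg n {v. refl_height n v \<in> A} (\<lambda>v. (step_avg n A ^^ T) f (refl_height n v)) v"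
    by (rule step_avg_cong[OF _ Suc.prems]) (rule Suc.IH)
  also have "\<dots> = step_avg n A ((step_avg n A ^^ T) f) (refl_height n v)"
    by (rule step_avg_refl_height[OF Suc.prems])
  finally show ?case by (simp only: funpow.simps o_apply)
qed simp

section \<open>Decay of the survival probability\<close>

text \<open>Moves inside the grid that never wrap around suffice, so the plain l^1-distance of
  indices can replace the graph distance.\<close>

lemma exists_move_closer:
  assumes "(i, j) \<in> cyl n" "(k, l) \<in> cyl n" "(i, j) \<noteq> (k, l)"
  shows "\<exists>d. nat \<bar>int (fst (move n d (i, j))) - int k\<bar> + nat \<bar>int (snd (move n d (i, j))) - int l\<bar> + 1
    = nat \<bar>int i - int k\<bar> + nat \<bar>int j - int l\<bar>"
proof -
  consider "i < k" | "i > k" | "i = k" "j < l" | "i = k" "j > l"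
    using assms by force
  then show ?thesis
  proof cases
    case 1
    then show ?thesis using assms by (intro exI[of _ East]) (auto simp: cyl_def)
  next
    case 2
    then obtain m where "i = Suc m" by (cases i) auto
    then show ?thesis using assms 2 by (intro exI[of _ West]) (auto simp: cyl_def)
  next
    case 3
    then show ?thesis using assms by (intro exI[of _ North]) (auto simp: cyl_def)
  next
    case 4
    then show ?thesis using assms by (intro exI[of _ South]) (auto simp: cyl_def)
  qed
qed

text \<open>With \<open>d\<close> the \<open>l\<^sup>1\<close>-distance to a vertex of \<open>A\<close>, each step from outside \<open>A\<close> raises the
  expectation of \<open>8\<^sup>-\<^sup>d\<close> by a fixed amount, since with probability 1/4 it decreases \<open>d\<close>.\<close>

lemma survival_bound:
  assumes "A \<inter> cyl n \<noteq> {}"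
  obtains C where "\<And>T v. v \<in> cyl n \<Longrightarrow>
    (step_avg n A ^^ T) (\<lambda>v. of_bool (v \<notin> A)) v \<le> C / (real T + 1)"
proof -
  obtain k l where kl: "(k, l) \<in> A" "(k, l) \<in> cyl n" using assms by force
  define dst where "dst = (\<lambda>v :: vertex. nat \<bar>int (fst v) - int k\<bar> + nat \<bar>int (snd v) - int l\<bar>)"
  \<comment> \<open>A move closer multiplies \<psi> by 8. Taken with probability 1/4 it alone
    contributes 2\<psi> to the average, so the gain is at least \<psi>, and \<psi> \<ge> c because
    distances are at most 2n.\<close>
  define \<psi> where "\<psi> = (\<lambda>v. (1/8 :: real) ^ dst v)"
  define c where "c = (1/8 :: real) ^ (2 * n)"
  define N where "N = (\<lambda>v. of_bool (v \<notin> A) :: real)"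
  have \<psi>: "0 \<le> \<psi> v" "\<psi> v \<le> 1" for v by (auto simp: \<psi>_def power_le_one)
  have c: "c > 0" by (simp add: c_def)
  have drift: "\<psi> v + c * N v \<le> step_avg n A \<psi> v" if v: "v \<in> cyl n" for v
  proof (cases "v \<in> A")
    case False
    then obtain d where d: "dst (move n d v) + 1 = dst v"
      using exists_move_closer[of "fst v" "snd v" n k l] v kl by (force simp: dst_def)
    have "dst v \<le> 2 * n" using v kl by (auto simp: dst_def cyl_def)
    then have "c \<le> \<psi> v" unfolding c_def \<psi>_def by (intro power_decreasing) auto
    moreover have "\<psi> (move n d v) = 8 * \<psi> v"
      unfolding \<psi>_def d[symmetric] by simp
    moreover have "step_avg n A \<psi> v \<ge> \<psi> (move n d v) / 4"
      using False \<psi> by (cases d) (simp_all add: step_avg_def)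
    ultimately show ?thesis using False by (simp add: N_def)
  qed (simp add: step_avg_def N_def)
  define P where "P = (\<lambda>T. (step_avg n A ^^ T))"
  have lin: "step_avg n A (\<lambda>v. f v + c * f' v) v = step_avg n A f v + c * step_avg n A f' v" for f f' v
    by (simp add: step_avg_def field_simps)
  have linT: "P T (\<lambda>v. f v + c * f' v) = (\<lambda>v. P T f v + c * P T f' v)" for T f f'
    by (induction T) (simp_all add: P_def lin)
  have PSuc: "P (Suc T) f = P T (step_avg n A f)" for T f
    by (simp only: P_def funpow_swap1 funpow.simps o_apply)
  \<comment> \<open>Iterating the drift inequality bounds c times the expected time spent off
    A.\<close>
  have sum: "\<psi> v + c * (\<Sum>t<T. P t N v) \<le> P T \<psi> v" if v: "v \<in> cyl n" for v T
  proof (induction T)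
    case (Suc T)
    have "P T \<psi> v + c * P T N v = P T (\<lambda>v. \<psi> v + c * N v) v" by (simp add: linT)
    also have "\<dots> \<le> P T (step_avg n A \<psi>) v"
      unfolding P_def using drift v by (intro funpow_step_avg_mono) auto
    finally show ?case using Suc by (simp add: PSuc algebra_simps)
  qed (simp add: P_def)
  have "step_avg n A N v \<le> N v" for v by (auto simp: step_avg_def N_def)
  then have "P (Suc T) N v \<le> P T N v" if "v \<in> cyl n" for T v
    unfolding PSuc unfolding P_def using that by (intro funpow_step_avg_mono) auto
  then have dec: "P T N v \<le> P t N v" if "v \<in> cyl n" "t \<le> T" for T t v
    using decseqD[OF decseq_SucI[of "\<lambda>t. P t N v"]] that by blast
  \<comment> \<open>The survival probability decreases in time, so T + 1 copies of its last value
    are at most the bounded sum. The rate 1/T is crude, but only the limit matters.\<close>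
  have "P T N v \<le> (1 / c) / (real T + 1)" if v: "v \<in> cyl n" for T v
  proof -
    have "c * ((T + 1) * P T N v) = c * (\<Sum>t<Suc T. P T N v)" by simp
    also have "\<dots> \<le> c * (\<Sum>t<Suc T. P t N v)"
      using c dec[OF v] by (intro mult_left_mono sum_mono) auto
    also have "\<dots> \<le> P (Suc T) \<psi> v" using sum[OF v, of "Suc T"] \<psi>(1)[of v] by linarith
    also have "\<dots> \<le> P (Suc T) (\<lambda>_. 1) v"
      unfolding P_def using \<psi> v by (intro funpow_step_avg_mono) auto
    also have "\<dots> = 1" by (simp add: P_def funpow_step_avg_const step_avg_const)
    finally have "P T N v * (c * (real T + 1)) \<le> 1" by (simp add: algebra_simps)
    then have "P T N v \<le> 1 / (c * (real T + 1))" using c by (subst pos_le_divide_eq) auto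
    then show ?thesis by (simp add: add.commute)
  qed
  then show ?thesis using that unfolding P_def N_def by blast
qed

section \<open>The stopped walk\<close>

text \<open>The position at time t depends on finitely many directions and is defined on every path,
  unlike \<open>first_visited\<close>; its law is therefore computable by iteration.\<close>

primrec stopped :: "nat \<Rightarrow> vertex set \<Rightarrow> vertex \<times> (nat \<Rightarrow> direction) \<Rightarrow> nat \<Rightarrow> vertex" where
  "stopped n A w 0 = fst w"
| "stopped n A w (Suc t) = (if stopped n A w t \<in> A then stopped n A w t
     else move n (snd w t) (stopped n A w t))"

lemma stopped_eq_walk:
  "stopped n A w t = walk n w (if \<exists>s\<le>t. walk n w s \<in> A then LEAST s. walk n w s \<in> A else t)"
proof (induction t)
  case 0
  then show ?case by (auto simp: Least_eq_0)
next
  case (Suc t)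
  show ?case
  proof (cases "\<exists>s\<le>t. walk n w s \<in> A")
    case True
    then have "walk n w (LEAST s. walk n w s \<in> A) \<in> A" by (auto intro: LeastI)
    then show ?thesis using Suc True by (auto simp: le_Suc_eq)
  next
    case False
    show ?thesis
    proof (cases "walk n w (Suc t) \<in> A")
      case True
      then have "(LEAST s. walk n w s \<in> A) = Suc t"
        using False by (intro Least_equality) (auto simp: not_less_eq_eq[symmetric])
      then show ?thesis using Suc False True by auto
    next
      case walk: False
      then show ?thesis using Suc False by (auto simp: le_Suc_eq)
    qed
  qed
qed

lemma walk_in_cyl: "fst w \<in> cyl n \<Longrightarrow> walk n w t \<in> cyl n"
  by (induction t) (auto intro: move_in_cyl)

lemma stopped_in_cyl: "fst w \<in> cyl n \<Longrightarrow> stopped n A w t \<in> cyl n"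
  by (induction t) (auto intro: move_in_cyl)

lemma first_visited_in_cyl: "fst w \<in> cyl n \<Longrightarrow> first_visited n A w \<in> cyl n"
  by (simp add: first_visited_def walk_in_cyl)

text \<open>If the first entrance into the larger set happens at a point of A, it is also the first
  entrance into A. In the applications the larger set is A together with an end row.\<close>

lemma first_visited_eq_stopped:
  assumes "stopped n A' w t \<in> A" "A \<subseteq> A'"
  shows "first_visited n A w = stopped n A' w t"
proof -
  define s where "s = (if \<exists>s\<le>t. walk n w s \<in> A' then LEAST s. walk n w s \<in> A' else t)"
  have eq: "stopped n A' w t = walk n w s" unfolding s_def by (rule stopped_eq_walk)
  have "s = (LEAST s. walk n w s \<in> A')"
  proof (rule Least_equality[symmetric])
    show "walk n w s \<in> A'" using assms eq by auto
    then show "s \<le> r" if "walk n w r \<in> A'" for r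
      using that by (auto simp: s_def split: if_splits intro: Least_le)
  qed
  then have "(LEAST s. walk n w s \<in> A) = s"
    using assms eq by (intro Least_equality) (auto intro: Least_le)
  then show ?thesis using eq by (simp add: first_visited_def)
qed

text \<open>First-step decomposition: \<open>case_nat d \<omega>\<close> puts d in front of
  \<omega>. For v in A the walk stays at v, so discarding d is harmless.\<close>

lemma stopped_case_nat:
  "stopped n A (v, case_nat d \<omega>) (Suc t) = stopped n A (if v \<in> A then v else move n d v, \<omega>) t"
  by (induction t) simp_all

instance direction :: finite
  by standard (rule finite_subset[of _ "{East, West, North, South}"], use direction.exhaust in auto)

abbreviation direction_space :: "(nat \<Rightarrow> direction) measure" where
  "direction_space \<equiv> (\<Pi>\<^sub>M t\<in>(UNIV :: nat set). measure_pmf (pmf_of_set {East, West, North, South}))"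

interpretation directions: sequence_space "measure_pmf (pmf_of_set {East, West, North, South})"
  by unfold_locales

lemma measurable_stopped [measurable]:
  "(\<lambda>\<omega>. stopped n A (v, \<omega>) t) \<in> direction_space \<rightarrow>\<^sub>M count_space UNIV"
proof (induction t)
  case (Suc t)
  have [measurable]: "(\<lambda>\<omega>. move n (\<omega> t) x) \<in> direction_space \<rightarrow>\<^sub>M count_space UNIV" for x
    by measurable
  have "(\<lambda>\<omega>. (\<lambda>x \<omega>. if x \<in> A then x else move n (\<omega> t) x) (stopped n A (v, \<omega>) t) \<omega>)
    \<in> direction_space \<rightarrow>\<^sub>M count_space UNIV"
    by (rule measurable_compose_countable[OF _ Suc]) measurable
  then show ?case by (simp only: stopped.simps snd_conv)
qed simp

text \<open>Markov property by induction on t, peeling off the first direction; v is generalised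
  because the remaining walk starts at a neighbour.\<close>

lemma integral_stopped:
  fixes f :: "vertex \<Rightarrow> real"
  assumes "v \<in> cyl n"
  shows "(\<integral>\<omega>. f (stopped n A (v, \<omega>) t) \<partial>direction_space) = (step_avg n A ^^ t) f v"
  using assms
proof (induction t arbitrary: v)
  case 0
  then show ?case by (simp add: directions.P.prob_space)
next
  case (Suc t)
  let ?D = "measure_pmf (pmf_of_set {East, West, North, South})"
  define C where "C = Max ((\<lambda>v. \<bar>f v\<bar>) ` cyl n)"
  have C: "\<bar>f x\<bar> \<le> C" if "x \<in> cyl n" for x using that by (simp add: C_def)
  define \<phi> where "\<phi> = (\<lambda>\<omega>. f (stopped n A (v, \<omega>) (Suc t)))"
  have meas: "\<phi> \<in> borel_measurable direction_space"
    unfolding \<phi>_def by (rule measurable_compose[OF measurable_stopped]) simp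
  interpret pair_prob_space ?D direction_space ..
  \<comment> \<open>By \<open>PiM_iter\<close>, prepending an independent direction preserves the
    law of the direction sequence. Fubini then applies, since f is bounded by C on the finite
    cylinder.\<close>
  have cn[measurable]: "(\<lambda>(d, \<omega>). case_nat d \<omega>) \<in> ?D \<Otimes>\<^sub>M direction_space \<rightarrow>\<^sub>M direction_space"
    by measurable
  have "integral\<^sup>L direction_space \<phi> = (\<integral>x. \<phi> (case x of (d, \<omega>) \<Rightarrow> case_nat d \<omega>) \<partial>(?D \<Otimes>\<^sub>M direction_space))"
    by (subst directions.PiM_iter[symmetric]) (rule integral_distr[OF cn meas])
  also have "\<dots> = (\<integral>d. \<integral>\<omega>. \<phi> (case_nat d \<omega>) \<partial>direction_space \<partial>?D)"
  proof (subst integral_fst'[symmetric])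
    have "\<phi> \<circ> (\<lambda>(d, \<omega>). case_nat d \<omega>) \<in> borel_measurable (?D \<Otimes>\<^sub>M direction_space)"
      using meas by measurable
    then show "integrable (?D \<Otimes>\<^sub>M direction_space) (\<lambda>x. \<phi> (case x of (d, \<omega>) \<Rightarrow> case_nat d \<omega>))"
      using Suc.prems by (intro integrable_const_bound[of _ C])
        (auto simp: comp_def \<phi>_def intro!: C stopped_in_cyl AE_I2 simp del: stopped.simps)
  qed simp
  also have "\<dots> = (\<integral>d. (step_avg n A ^^ t) f (if v \<in> A then v else move n d v) \<partial>?D)"
    unfolding \<phi>_def stopped_case_nat using Suc
    by (intro Bochner_Integration.integral_cong refl Suc.IH) (auto intro: move_in_cyl)
  also have "\<dots> = step_avg n A ((step_avg n A ^^ t) f) v"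
    by (subst integral_pmf_of_set) (auto simp: step_avg_def)
  finally show ?case by (simp add: \<phi>_def)
qed

lemma measurable_first_visited [measurable]:
  "(\<lambda>\<omega>. first_visited n A (v, \<omega>)) \<in> direction_space \<rightarrow>\<^sub>M count_space UNIV"
proof -
  \<comment> \<open>Freezing on the empty set gives the free walk, whose measurability is thus
    already known.\<close>
  have walk_eq: "stopped n {} w t = walk n w t" for w t by (induction t) simp_all
  have [measurable]: "(\<lambda>\<omega>. walk n (v, \<omega>) t) \<in> direction_space \<rightarrow>\<^sub>M count_space UNIV" for t
    using measurable_stopped[of n "{}" v t] by (simp add: walk_eq)
  have "(\<lambda>\<omega>. LEAST t. walk n (v, \<omega>) t \<in> A) \<in> direction_space \<rightarrow>\<^sub>M count_space UNIV"
    by measurable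
  then show ?thesis
    unfolding first_visited_def by (rule measurable_compose_countable[rotated]) measurable
qed

lemma measurable_walk_space:
  assumes "\<And>v. (\<lambda>\<omega>. \<phi> (v, \<omega>)) \<in> direction_space \<rightarrow>\<^sub>M N"
  shows "\<phi> \<in> walk_space n j \<rightarrow>\<^sub>M N"
proof -
  have "\<phi> \<in> count_space UNIV \<Otimes>\<^sub>M direction_space \<rightarrow>\<^sub>M N"
    by (rule measurable_pair_measure_countable1) (use assms in auto)
  then show ?thesis
    by (simp add: walk_space_def cong: measurable_cong_sets sets_pair_measure_cong)
qed

lemma prob_space_walk_space: "prob_space (walk_space n j)"
  unfolding walk_space_def
  by (intro prob_space_pair prob_space_measure_pmf directions.P.prob_space_axioms)

lemma
  fixes \<phi> :: "vertex \<times> (nat \<Rightarrow> direction) \<Rightarrow> real"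
  assumes n: "n \<ge> 1" and meas: "\<And>v. (\<lambda>\<omega>. \<phi> (v, \<omega>)) \<in> borel_measurable direction_space"
    and bound: "\<And>w. \<bar>\<phi> w\<bar> \<le> C"
  shows integrable_walk_space: "integrable (walk_space n j) \<phi>"
    and integral_walk_space:
      "(\<integral>w. \<phi> w \<partial>walk_space n j) = (\<Sum>i<n. \<integral>\<omega>. \<phi> ((i, j), \<omega>) \<partial>direction_space) / n"
proof -
  interpret prob_space "walk_space n j" by (rule prob_space_walk_space)
  show int: "integrable (walk_space n j) \<phi>"
    by (rule integrable_const_bound[of _ C])
      (use bound measurable_walk_space[of \<phi> borel, OF meas] in auto)
  let ?U = "measure_pmf (pmf_of_set ({..<n} \<times> {j}))"
  interpret U: pair_prob_space ?U direction_space ..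
  have "(\<integral>w. \<phi> w \<partial>walk_space n j) = (\<integral>v. \<integral>\<omega>. \<phi> (v, \<omega>) \<partial>direction_space \<partial>?U)"
    unfolding walk_space_def by (rule U.integral_fst'[symmetric]) (use int in \<open>simp add: walk_space_def\<close>)
  also have "\<dots> = (\<Sum>v\<in>{..<n} \<times> {j}. \<integral>\<omega>. \<phi> (v, \<omega>) \<partial>direction_space) / n"
    using n by (subst integral_pmf_of_set) (auto simp: lessThan_empty_iff)
  also have "(\<Sum>v\<in>{..<n} \<times> {j}. \<integral>\<omega>. \<phi> (v, \<omega>) \<partial>direction_space)
      = (\<Sum>i<n. \<integral>\<omega>. \<phi> ((i, j), \<omega>) \<partial>direction_space)"
    by (rule sum.reindex_bij_witness[of _ "\<lambda>i. (i, j)" fst]) auto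
  finally show "(\<integral>w. \<phi> w \<partial>walk_space n j) = (\<Sum>i<n. \<integral>\<omega>. \<phi> ((i, j), \<omega>) \<partial>direction_space) / n" .
qed

lemma integrable_stopped:
  fixes f :: "vertex \<Rightarrow> real"
  assumes "v \<in> cyl n"
  shows "integrable direction_space (\<lambda>\<omega>. f (stopped n A (v, \<omega>) t))"
proof (rule directions.P.integrable_const_bound)
  show "AE \<omega> in direction_space. norm (f (stopped n A (v, \<omega>) t)) \<le> Max ((\<lambda>v. \<bar>f v\<bar>) ` cyl n)"
    using assms by (auto intro!: AE_I2 Max_ge stopped_in_cyl)
  show "(\<lambda>\<omega>. f (stopped n A (v, \<omega>) t)) \<in> borel_measurable direction_space"
    by (rule measurable_compose[OF measurable_stopped]) simp
qed

section \<open>The drift\<close>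

lemma h_bounds: "n \<ge> 1 \<Longrightarrow> 0 \<le> h n \<sigma>" "n \<ge> 1 \<Longrightarrow> h n \<sigma> \<le> card (cyl n)"
proof -
  assume n: "n \<ge> 1"
  then have v: "0 \<le> (case v of (i, j) \<Rightarrow> 1 - height n j)" if "v \<in> cyl n" for v
    using that by (auto simp: cyl_def height_def)
  have sub: "coloured n \<sigma> Blue \<subseteq> cyl n" by (auto simp: coloured_def)
  show "0 \<le> h n \<sigma>" unfolding h_def using v sub by (intro sum_nonneg) auto
  have "h n \<sigma> \<le> (\<Sum>v\<in>cyl n. case v of (i, j) \<Rightarrow> 1 - height n j)"
    unfolding h_def using v sub by (intro sum_mono2) auto
  also have "\<dots> \<le> (\<Sum>v\<in>cyl n. 1)" by (intro sum_mono) (auto simp: height_def)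
  finally show "h n \<sigma> \<le> card (cyl n)" by simp
qed

lemma finite_coloured [simp]: "finite (coloured n \<sigma> c)"
  by (simp add: coloured_def)

text \<open>For the vertex found by the blue walk, the second case arises only on paths that miss
  the red set, where \<open>first_visited\<close> is unspecified; h is then unchanged.\<close>

lemma h_recolour_Blue:
  assumes "z \<in> cyl n"
  shows "h n (\<sigma>(z := Blue)) - h n \<sigma> = (if \<sigma> z = Red then 1 - height n (snd z) else 0)"
proof (cases "\<sigma> z = Red")
  case True
  have "coloured n (\<sigma>(z := Blue)) Blue = insert z (coloured n \<sigma> Blue)"
    using assms by (auto simp: coloured_def)
  moreover have "z \<notin> coloured n \<sigma> Blue" using True by (simp add: coloured_def)
  ultimately show ?thesis using True by (simp add: h_def split_def)
next
  case False
  then have "\<sigma>(z := Blue) = \<sigma>" by (cases "\<sigma> z") auto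
  then show ?thesis using False by simp
qed

lemma h_recolour_Red:
  assumes "z \<in> cyl n"
  shows "h n \<sigma> - h n (\<sigma>(z := Red)) = (if \<sigma> z = Blue then 1 - height n (snd z) else 0)"
  using h_recolour_Blue[OF assms, of "\<sigma>(z := Red)"] by (cases "\<sigma> z") (auto simp: fun_upd_idem)

text \<open>Couple the blue walk with the same walk stopped also on the top row. If the latter stops
  on red, both end at the same vertex; if it stops on the top row, its height 1 dominates. Paths not
  absorbed by time T have probability O(1/T), and T tends to infinity.\<close>

lemma expected_blue_gain:
  assumes n: "n \<ge> 1" and red: "coloured n \<sigma> Red \<noteq> {}"
    and M: "\<And>T. (\<Sum>i<n. (step_avg n (coloured n \<sigma> Red \<union> {..<n} \<times> {n}) ^^ T) (height n \<circ> snd) (i, 0)) / n \<le> M"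
  shows "(\<integral>w. h n (blue_step n \<sigma> w) - h n \<sigma> \<partial>walk_space n 0) \<ge> 1 - M"
proof -
  define R where "R = coloured n \<sigma> Red"
  define A where "A = R \<union> {..<n} \<times> {n}"
  let ?f = "height n \<circ> snd"
  have "R \<inter> cyl n \<noteq> {}" "A \<inter> cyl n \<noteq> {}" using red by (auto simp: A_def R_def coloured_def)
  obtain C1 where C1: "\<And>T v. v \<in> cyl n \<Longrightarrow> (step_avg n R ^^ T) (\<lambda>v. of_bool (v \<notin> R)) v \<le> C1 / (real T + 1)"
    using survival_bound[OF \<open>R \<inter> cyl n \<noteq> {}\<close>] by blast
  obtain C2 where C2: "\<And>T v. v \<in> cyl n \<Longrightarrow> (step_avg n A ^^ T) (\<lambda>v. of_bool (v \<notin> A)) v \<le> C2 / (real T + 1)"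
    using survival_bound[OF \<open>A \<inter> cyl n \<noteq> {}\<close>] by blast
  \<comment> \<open>If either walk is still running at time T, the left side is at most 0 and the
    right side is nonnegative. Absorption in R is tracked separately because stopping on the top row
    does not show that red is ever reached.\<close>
  have pointwise: "1 - ?f (stopped n A w T) - of_bool (stopped n A w T \<notin> A) - of_bool (stopped n R w T \<notin> R)
      \<le> h n (blue_step n \<sigma> w) - h n \<sigma>" if w: "fst w \<in> cyl n" for w T
  proof -
    define z where "z = first_visited n R w"
    have z: "z \<in> cyl n" unfolding z_def by (rule first_visited_in_cyl[OF w])
    have z1: "?f z \<le> 1" using z n by (auto simp: height_def cyl_def)
    have f0: "0 \<le> ?f (stopped n A w T)" by (simp add: height_def)
    have diff: "h n (blue_step n \<sigma> w) - h n \<sigma> = (if \<sigma> z = Red then 1 - ?f z else 0)"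
      using h_recolour_Blue[OF z] by (simp add: blue_step_def z_def R_def)
    show ?thesis
    proof (cases "stopped n R w T \<in> R \<and> stopped n A w T \<in> A")
      case True
      then have "z \<in> R" using first_visited_eq_stopped[of n R w T R] by (simp add: z_def)
      then have "\<sigma> z = Red" by (simp add: R_def coloured_def)
      moreover have "?f z \<le> ?f (stopped n A w T)"
      proof (cases "stopped n A w T \<in> R")
        case True
        then show ?thesis using first_visited_eq_stopped[of n A w T R] by (simp add: z_def A_def)
      next
        case False
        then have "?f (stopped n A w T) = 1" using True n by (auto simp: A_def height_def)
        then show ?thesis using z1 by simp
      qed
      ultimately show ?thesis using diff True by simp
    next
      case False
      then show ?thesis using diff z1 f0 by auto
    qed
  qed
  have meas: "(\<lambda>\<omega>. h n (blue_step n \<sigma> (v, \<omega>)) - h n \<sigma>) \<in> borel_measurable direction_space" for v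
    unfolding blue_step_def
    by (rule measurable_compose[OF measurable_first_visited, of "\<lambda>z. h n (\<sigma>(z := Blue)) - h n \<sigma>"]) simp
  have bound: "\<bar>h n (blue_step n \<sigma> w) - h n \<sigma>\<bar> \<le> card (cyl n)" for w
    using h_bounds[OF n, of \<sigma>] h_bounds[OF n, of "blue_step n \<sigma> w"] by linarith
  have lower: "(\<integral>w. h n (blue_step n \<sigma> w) - h n \<sigma> \<partial>walk_space n 0) \<ge> 1 - M - (C1 + C2) / (real T + 1)" for T
  proof -
    have "1 - (step_avg n A ^^ T) ?f (i, 0) - (C1 + C2) / (real T + 1)
      \<le> (\<integral>\<omega>. h n (blue_step n \<sigma> ((i, 0), \<omega>)) - h n \<sigma> \<partial>direction_space)" if "i < n" for i
    proof -
      have i: "(i, 0) \<in> cyl n" using that by (simp add: cyl_def)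
      note int = integrable_stopped[OF i]
      have "1 - (step_avg n A ^^ T) ?f (i, 0) - (step_avg n A ^^ T) (\<lambda>v. of_bool (v \<notin> A)) (i, 0)
          - (step_avg n R ^^ T) (\<lambda>v. of_bool (v \<notin> R)) (i, 0)
        = (\<integral>\<omega>. 1 - ?f (stopped n A ((i, 0), \<omega>) T) - of_bool (stopped n A ((i, 0), \<omega>) T \<notin> A)
            - of_bool (stopped n R ((i, 0), \<omega>) T \<notin> R) \<partial>direction_space)"
        using int[of ?f A T] int[of "\<lambda>v. of_bool (v \<notin> A)" A T] int[of "\<lambda>v. of_bool (v \<notin> R)" R T]
        by (simp add: integral_stopped[OF i, symmetric] directions.P.prob_space del: o_apply)
      also have "\<dots> \<le> (\<integral>\<omega>. h n (blue_step n \<sigma> ((i, 0), \<omega>)) - h n \<sigma> \<partial>direction_space)"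
      proof (rule integral_mono)
        show "integrable direction_space (\<lambda>\<omega>. 1 - ?f (stopped n A ((i, 0), \<omega>) T)
            - of_bool (stopped n A ((i, 0), \<omega>) T \<notin> A) - of_bool (stopped n R ((i, 0), \<omega>) T \<notin> R))"
          using int[of ?f A T] int[of "\<lambda>v. of_bool (v \<notin> A)" A T] int[of "\<lambda>v. of_bool (v \<notin> R)" R T]
          by (intro Bochner_Integration.integrable_diff) auto
        show "integrable direction_space (\<lambda>\<omega>. h n (blue_step n \<sigma> ((i, 0), \<omega>)) - h n \<sigma>)"
          using meas bound by (intro directions.P.integrable_const_bound[of _ "card (cyl n)"]) auto
      qed (use pointwise[of "((i, 0), _)" T] i in simp)
      finally show ?thesis using C1[OF i, of T] C2[OF i, of T] by (simp add: add_divide_distrib)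
    qed
    then have "(\<Sum>i<n. 1 - (step_avg n A ^^ T) ?f (i, 0) - (C1 + C2) / (real T + 1)) / n
      \<le> (\<integral>w. h n (blue_step n \<sigma> w) - h n \<sigma> \<partial>walk_space n 0)"
      unfolding integral_walk_space[OF n meas bound] by (intro divide_right_mono sum_mono) auto
    moreover have "(\<Sum>i<n. 1 - (step_avg n A ^^ T) ?f (i, 0) - (C1 + C2) / (real T + 1)) / n
      = 1 - (C1 + C2) / (real T + 1) - (\<Sum>i<n. (step_avg n A ^^ T) ?f (i, 0)) / n"
      using n by (simp add: sum_subtractf diff_divide_distrib del: o_apply)
    ultimately show ?thesis using M[of T] unfolding A_def R_def by linarith
  qed
  have "(\<lambda>T. 1 - M - (C1 + C2) * inverse (real (Suc T))) \<longlonglongrightarrow> 1 - M - (C1 + C2) * 0"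
    by (intro tendsto_intros LIMSEQ_inverse_real_of_nat)
  then have "(\<lambda>T. 1 - M - (C1 + C2) / (real T + 1)) \<longlonglongrightarrow> 1 - M"
    by (simp add: divide_inverse add.commute)
  then show ?thesis
    by (rule LIMSEQ_le_const2) (use lower in auto)
qed

text \<open>The same coupling for the red walk, with the bottom row added. One survival term is
  enough for this upper bound: a walk that misses blue causes no loss.\<close>

lemma expected_red_loss:
  assumes n: "n \<ge> 1"
    and M: "\<And>T. (\<Sum>i<n. (step_avg n (coloured n \<tau> Blue \<union> {..<n} \<times> {0}) ^^ T)
      (\<lambda>v. 1 - height n (snd v)) (i, n)) / n \<le> M"
  shows "(\<integral>w. h n \<tau> - h n (red_step n \<tau> w) \<partial>walk_space n n) \<le> M"
proof -
  define B where "B = coloured n \<tau> Blue"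
  define A where "A = B \<union> {..<n} \<times> {0}"
  let ?f = "\<lambda>v. 1 - height n (snd v)"
  have "(0, 0) \<in> A \<inter> cyl n" using n by (auto simp: A_def cyl_def)
  then obtain C where C: "\<And>T v. v \<in> cyl n \<Longrightarrow> (step_avg n A ^^ T) (\<lambda>v. of_bool (v \<notin> A)) v \<le> C / (real T + 1)"
    using survival_bound[of A n] by blast
  have pointwise: "h n \<tau> - h n (red_step n \<tau> w) \<le> ?f (stopped n A w T) + of_bool (stopped n A w T \<notin> A)"
    if w: "fst w \<in> cyl n" for w T
  proof -
    define z where "z = first_visited n B w"
    have z: "z \<in> cyl n" unfolding z_def by (rule first_visited_in_cyl[OF w])
    have f: "0 \<le> ?f v" "?f v \<le> 1" if "v \<in> cyl n" for v using that n by (auto simp: height_def cyl_def)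
    have "h n \<tau> - h n (red_step n \<tau> w) \<le> ?f z"
      using h_recolour_Red[OF z] f(1)[OF z] by (simp add: red_step_def z_def B_def)
    also have "?f z \<le> ?f (stopped n A w T) + of_bool (stopped n A w T \<notin> A)"
    proof (cases "stopped n A w T \<in> B")
      case True
      then show ?thesis using first_visited_eq_stopped[of n A w T B] by (simp add: z_def A_def)
    next
      case False
      then have "stopped n A w T \<in> A \<Longrightarrow> ?f (stopped n A w T) = 1" by (auto simp: A_def height_def)
      then show ?thesis using f[OF z] f[OF stopped_in_cyl[OF w, of A T]] by auto
    qed
    finally show ?thesis .
  qed
  have meas: "(\<lambda>\<omega>. h n \<tau> - h n (red_step n \<tau> (v, \<omega>))) \<in> borel_measurable direction_space" for v
    unfolding red_step_def
    by (rule measurable_compose[OF measurable_first_visited, of "\<lambda>z. h n \<tau> - h n (\<tau>(z := Red))"]) simp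
  have bound: "\<bar>h n \<tau> - h n (red_step n \<tau> w)\<bar> \<le> card (cyl n)" for w
    using h_bounds[OF n, of \<tau>] h_bounds[OF n, of "red_step n \<tau> w"] by linarith
  have upper: "(\<integral>w. h n \<tau> - h n (red_step n \<tau> w) \<partial>walk_space n n) \<le> M + C / (real T + 1)" for T
  proof -
    have "(\<integral>\<omega>. h n \<tau> - h n (red_step n \<tau> ((i, n), \<omega>)) \<partial>direction_space)
      \<le> (step_avg n A ^^ T) ?f (i, n) + C / (real T + 1)" if "i < n" for i
    proof -
      have i: "(i, n) \<in> cyl n" using that by (simp add: cyl_def)
      note int = integrable_stopped[OF i]
      have "(\<integral>\<omega>. h n \<tau> - h n (red_step n \<tau> ((i, n), \<omega>)) \<partial>direction_space)
        \<le> (\<integral>\<omega>. ?f (stopped n A ((i, n), \<omega>) T) + of_bool (stopped n A ((i, n), \<omega>) T \<notin> A) \<partial>direction_space)"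
      proof (rule integral_mono)
        show "integrable direction_space (\<lambda>\<omega>. ?f (stopped n A ((i, n), \<omega>) T)
            + of_bool (stopped n A ((i, n), \<omega>) T \<notin> A))"
          using int[of ?f A T] int[of "\<lambda>v. of_bool (v \<notin> A)" A T]
          by (intro Bochner_Integration.integrable_add) auto
        show "integrable direction_space (\<lambda>\<omega>. h n \<tau> - h n (red_step n \<tau> ((i, n), \<omega>)))"
          using meas bound by (intro directions.P.integrable_const_bound[of _ "card (cyl n)"]) auto
      qed (use pointwise[of "((i, n), _)" T] i in simp)
      also have "\<dots> = (step_avg n A ^^ T) ?f (i, n) + (step_avg n A ^^ T) (\<lambda>v. of_bool (v \<notin> A)) (i, n)"
        unfolding integral_stopped[OF i, symmetric]
        by (rule Bochner_Integration.integral_add) (use int[of ?f A T] int[of "\<lambda>v. of_bool (v \<notin> A)" A T] in auto)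
      finally show ?thesis using C[OF i, of T] by simp
    qed
    then have "(\<integral>w. h n \<tau> - h n (red_step n \<tau> w) \<partial>walk_space n n)
      \<le> (\<Sum>i<n. (step_avg n A ^^ T) ?f (i, n) + C / (real T + 1)) / n"
      unfolding integral_walk_space[OF n meas bound] by (intro divide_right_mono sum_mono) auto
    moreover have "(\<Sum>i<n. (step_avg n A ^^ T) ?f (i, n) + C / (real T + 1)) / n
      = (\<Sum>i<n. (step_avg n A ^^ T) ?f (i, n)) / n + C / (real T + 1)"
      using n by (simp add: sum.distrib add_divide_distrib)
    ultimately show ?thesis using M[of T] unfolding A_def B_def by linarith
  qed
  have "(\<lambda>T. M + C * inverse (real (Suc T))) \<longlonglongrightarrow> M + C * 0"
    by (intro tendsto_intros LIMSEQ_inverse_real_of_nat)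
  then have "(\<lambda>T. M + C / (real T + 1)) \<longlonglongrightarrow> M"
    by (simp add: divide_inverse add.commute)
  then show ?thesis
    by (rule LIMSEQ_le_const) (use upper in auto)
qed

text \<open>Fubini over the two independent walks. The bound on the red loss is uniform in the
  vertex z recoloured first, so the law of z is irrelevant.\<close>

lemma expected_drift:
  assumes n: "n \<ge> 1"
    and blue: "(\<integral>w. h n (blue_step n \<sigma> w) - h n \<sigma> \<partial>walk_space n 0) \<ge> 1 - M"
    and red: "\<And>z. z \<in> cyl n \<Longrightarrow>
      (\<integral>w. h n (\<sigma>(z := Blue)) - h n (red_step n (\<sigma>(z := Blue)) w) \<partial>walk_space n n) \<le> M'"
  shows "(\<integral>\<omega>. h n (erosion n \<sigma> 1 \<omega>) - h n (erosion n \<sigma> 0 \<omega>) \<partial>erosion_space n) \<ge> 1 - M - M'"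
proof -
  let ?W0 = "walk_space n 0" and ?W1 = "walk_space n n"
  let ?K = "real (card (cyl n))"
  interpret W0: prob_space ?W0 by (rule prob_space_walk_space)
  interpret W1: prob_space ?W1 by (rule prob_space_walk_space)
  interpret W: pair_prob_space ?W0 ?W1 ..
  define \<phi> where "\<phi> = (\<lambda>(w, w'). h n (red_step n (blue_step n \<sigma> w) w') - h n \<sigma>)"
  define loss where "loss = (\<lambda>z. \<integral>w. h n (\<sigma>(z := Blue)) - h n (red_step n (\<sigma>(z := Blue)) w) \<partial>?W1)"
  let ?fv = "first_visited n (coloured n \<sigma> Red)"
  have hb: "\<bar>h n s - h n s'\<bar> \<le> ?K" for s s'
    using h_bounds[OF n, of s] h_bounds[OF n, of s'] by linarith
  have red_meas: "(\<lambda>w. h n (red_step n s w)) \<in> borel_measurable ?W1" for s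
    unfolding red_step_def
    by (intro measurable_walk_space measurable_compose[OF measurable_first_visited, of "\<lambda>z. h n (s(z := Red))"]) simp
  have fv: "?fv \<in> ?W0 \<rightarrow>\<^sub>M count_space UNIV"
    by (intro measurable_walk_space measurable_first_visited)
  \<comment> \<open>Configurations form an uncountable type; measurability goes through the
    recoloured vertex, which has countably many possible values.\<close>
  have "(\<lambda>x. (\<lambda>z x. h n (red_step n (\<sigma>(z := Blue)) (snd x)) - h n \<sigma>) (?fv (fst x)) x)
      \<in> borel_measurable (?W0 \<Otimes>\<^sub>M ?W1)"
    by (rule measurable_compose_countable)
      (use red_meas fv in \<open>auto intro!: borel_measurable_diff measurable_compose[OF measurable_snd]
        measurable_compose[OF measurable_fst]\<close>)
  then have \<phi>_meas: "\<phi> \<in> borel_measurable (?W0 \<Otimes>\<^sub>M ?W1)"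
    by (simp add: \<phi>_def split_def blue_step_def)
  have \<phi>_int: "integrable (?W0 \<Otimes>\<^sub>M ?W1) \<phi>"
    by (rule W.P.integrable_const_bound[OF _ \<phi>_meas, of ?K]) (auto simp: \<phi>_def hb)
  have inner: "(\<integral>w'. \<phi> (w, w') \<partial>?W1) = (h n (blue_step n \<sigma> w) - h n \<sigma>) - loss (?fv w)" for w
  proof -
    have int: "integrable ?W1 (\<lambda>w'. h n (red_step n s w'))" for s
      using h_bounds[OF n] by (intro W1.integrable_const_bound[OF _ red_meas, where B = ?K]) auto
    show ?thesis
      using int by (simp add: \<phi>_def loss_def blue_step_def W1.prob_space)
  qed
  have loss_le: "\<bar>loss z\<bar> \<le> ?K" for z
  proof -
    have int: "integrable ?W1 (\<lambda>w. h n (\<sigma>(z := Blue)) - h n (red_step n (\<sigma>(z := Blue)) w))"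
      using hb red_meas by (intro W1.integrable_const_bound[of _ ?K]) auto
    have "\<bar>loss z\<bar> \<le> (\<integral>w. \<bar>h n (\<sigma>(z := Blue)) - h n (red_step n (\<sigma>(z := Blue)) w)\<bar> \<partial>?W1)"
      unfolding loss_def using integral_norm_bound[of ?W1] by simp
    also have "\<dots> \<le> (\<integral>w. ?K \<partial>?W1)"
      using int hb by (intro integral_mono) auto
    finally show ?thesis by (simp add: W1.prob_space)
  qed
  have loss_meas: "(\<lambda>\<omega>. loss (?fv (v, \<omega>))) \<in> borel_measurable direction_space" for v
    by (rule measurable_compose[OF measurable_first_visited]) simp
  have "(\<integral>w. loss (?fv w) \<partial>?W0) \<le> M'"
  proof -
    have "(\<integral>\<omega>. loss (?fv ((i, 0), \<omega>)) \<partial>direction_space) \<le> (\<integral>\<omega>. M' \<partial>direction_space)" if "i < n" for i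
    proof (rule integral_mono)
      show "integrable direction_space (\<lambda>\<omega>. loss (?fv ((i, 0), \<omega>)))"
        by (rule directions.P.integrable_const_bound[OF _ loss_meas, where B = ?K]) (simp add: loss_le)
      show "loss (?fv ((i, 0), \<omega>)) \<le> M'" for \<omega>
        unfolding loss_def using that by (intro red first_visited_in_cyl) (simp add: cyl_def)
    qed simp
    then have "(\<Sum>i<n. \<integral>\<omega>. loss (?fv ((i, 0), \<omega>)) \<partial>direction_space) \<le> (\<Sum>i<n. M')"
      by (intro sum_mono) (simp add: directions.P.prob_space)
    then show ?thesis
      unfolding integral_walk_space[OF n loss_meas loss_le] using n by (simp add: divide_le_eq mult.commute)
  qed
  moreover have "(\<integral>\<omega>. h n (erosion n \<sigma> 1 \<omega>) - h n (erosion n \<sigma> 0 \<omega>) \<partial>erosion_space n)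
      = (\<integral>w. h n (blue_step n \<sigma> w) - h n \<sigma> \<partial>?W0) - (\<integral>w. loss (?fv w) \<partial>?W0)"
  proof -
    have "(\<integral>\<omega>. h n (erosion n \<sigma> 1 \<omega>) - h n (erosion n \<sigma> 0 \<omega>) \<partial>erosion_space n)
        = (\<integral>\<omega>. \<phi> (\<omega> 0) \<partial>erosion_space n)"
      by (simp add: \<phi>_def split_def)
    \<comment> \<open>One step uses only the noise at time 0, whose law is the product of the two
      walk laws.\<close>
    also have "\<dots> = (\<integral>x. \<phi> x \<partial>distr (erosion_space n) (?W0 \<Otimes>\<^sub>M ?W1) (\<lambda>\<omega>. \<omega> 0))"
      by (rule integral_distr[symmetric]) (use \<phi>_meas in \<open>auto simp: erosion_space_def\<close>)
    also have "distr (erosion_space n) (?W0 \<Otimes>\<^sub>M ?W1) (\<lambda>\<omega>. \<omega> 0) = ?W0 \<Otimes>\<^sub>M ?W1"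
      unfolding erosion_space_def by (rule distr_PiM_component) (auto intro: W.P.prob_space_axioms)
    also have "(\<integral>x. \<phi> x \<partial>(?W0 \<Otimes>\<^sub>M ?W1)) = (\<integral>w. \<integral>w'. \<phi> (w, w') \<partial>?W1 \<partial>?W0)"
      by (rule W.integral_fst'[OF \<phi>_int, symmetric])
    also have "\<dots> = (\<integral>w. (h n (blue_step n \<sigma> w) - h n \<sigma>) - loss (?fv w) \<partial>?W0)"
      by (simp only: inner)
    also have "\<dots> = (\<integral>w. h n (blue_step n \<sigma> w) - h n \<sigma> \<partial>?W0) - (\<integral>w. loss (?fv w) \<partial>?W0)"
    proof (rule Bochner_Integration.integral_diff)
      have "(\<lambda>\<omega>. h n (blue_step n \<sigma> (v, \<omega>)) - h n \<sigma>) \<in> borel_measurable direction_space" for v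
        unfolding blue_step_def
        by (rule measurable_compose[OF measurable_first_visited, of "\<lambda>z. h n (\<sigma>(z := Blue)) - h n \<sigma>"]) simp
      then show "integrable ?W0 (\<lambda>w. h n (blue_step n \<sigma> w) - h n \<sigma>)"
        by (rule integrable_walk_space[OF n _ hb])
      show "integrable ?W0 (\<lambda>w. loss (?fv w))"
        by (rule integrable_walk_space[OF n loss_meas loss_le])
    qed
    finally show ?thesis .
  qed
  ultimately show ?thesis using blue by linarith
qed

section \<open>Quantitative gain from many bad rows\<close>

lemma card_nat_interval_le:
  fixes x y :: real
  assumes "x \<le> y"
  shows "card {j :: nat. x < j \<and> j \<le> y} \<le> y - x + 1"
proof -
  have "int ` {j :: nat. x < j \<and> j \<le> y} \<subseteq> {\<lfloor>x\<rfloor><..\<lfloor>y\<rfloor>}"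
    by (auto simp: floor_less_iff le_floor_iff)
  then have "card (int ` {j :: nat. x < j \<and> j \<le> y}) \<le> card {\<lfloor>x\<rfloor><..\<lfloor>y\<rfloor>}"
    by (intro card_mono) auto
  then have "card {j :: nat. x < j \<and> j \<le> y} \<le> nat (\<lfloor>y\<rfloor> - \<lfloor>x\<rfloor>)"
    by (simp add: card_image)
  moreover have "\<lfloor>x\<rfloor> \<le> \<lfloor>y\<rfloor>" using assms by (rule floor_mono)
  ultimately have "real (card {j :: nat. x < j \<and> j \<le> y}) \<le> \<lfloor>y\<rfloor> - \<lfloor>x\<rfloor>"
    by linarith
  then show ?thesis by linarith
qed

text \<open>At most \<epsilon> n/2 + 1 rows have height between \<beta> - \<epsilon>/2 and \<beta>,
  so at least \<epsilon> n/4 rows of J lie below; this uses \<epsilon> n \<ge> 4. With \<delta> =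
  \<epsilon>/8 the two alternatives become \<beta> - \<epsilon>/2 + 2\<delta> = \<beta> -
  \<epsilon>/4 and a saving of (\<epsilon>/4)(\<epsilon>/8)^2 = \<epsilon>^3/256.\<close>

lemma exit_height_gain:
  fixes \<beta> \<epsilon> :: real
  assumes n: "n \<ge> 1" and top: "\<And>i. i < n \<Longrightarrow> (i, n) \<in> A"
    and J: "J \<subseteq> {..n}" "\<And>j. j \<in> J \<Longrightarrow> \<exists>i<n. (i, j) \<in> A" "\<And>j. j \<in> J \<Longrightarrow> real j \<le> \<beta> * n"
    and \<epsilon>: "\<epsilon> > 0" and large: "card J > \<epsilon> * n" "\<epsilon> * n \<ge> 4"
  shows "(\<Sum>i<n. (step_avg n A ^^ T) (height n \<circ> snd) (i, 0)) / n
    \<le> max (\<beta> - \<epsilon> / 4) (card (cyl n - A) / (real n)\<^sup>2 - \<epsilon> ^ 3 / 256)"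
proof -
  define \<kappa> where "\<kappa> = \<beta> - \<epsilon> / 2"
  define J' where "J' = {j \<in> J. real j \<le> \<kappa> * n}"
  have finJ: "finite J" using J(1) finite_subset by blast
  have \<kappa>n: "\<kappa> * n \<le> \<beta> * n" using \<epsilon> by (intro mult_right_mono) (auto simp: \<kappa>_def)
  have "J \<subseteq> J' \<union> {j. \<kappa> * n < real j \<and> real j \<le> \<beta> * n}"
    using J(3) by (auto simp: J'_def)
  moreover have fin: "finite {j. \<kappa> * n < real j \<and> real j \<le> \<beta> * n}"
    by (rule finite_subset[of _ "{..nat \<lfloor>\<beta> * n\<rfloor>}"]) (auto simp: le_nat_floor)
  ultimately have "card J \<le> card (J' \<union> {j. \<kappa> * n < real j \<and> real j \<le> \<beta> * n})"
    using finJ by (intro card_mono) (auto simp: J'_def)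
  also have "\<dots> \<le> card J' + card {j. \<kappa> * n < real j \<and> real j \<le> \<beta> * n}"
    by (rule card_Un_le)
  finally have "real (card J) \<le> card J' + card {j. \<kappa> * n < real j \<and> real j \<le> \<beta> * n}" by simp
  also have "\<dots> \<le> card J' + (\<beta> * n - \<kappa> * n + 1)"
    using card_nat_interval_le[OF \<kappa>n] by simp
  also have "\<beta> * n - \<kappa> * n = \<epsilon> * n / 2" by (simp add: \<kappa>_def algebra_simps)
  finally have J'_large: "card J' \<ge> \<epsilon> / 4 * n" using large by linarith
  have "(\<Sum>i<n. (step_avg n A ^^ T) (height n \<circ> snd) (i, 0)) / n
    \<le> max (\<kappa> + 2 * (\<epsilon> / 8)) (card (cyl n - A) / (real n)\<^sup>2 - card J' * (\<epsilon> / 8)\<^sup>2 / n)"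
    using \<epsilon> J by (intro exit_height_bound[OF n top]) (auto simp: J'_def)
  moreover have "\<epsilon> ^ 3 / 256 \<le> card J' * (\<epsilon> / 8)\<^sup>2 / n"
  proof -
    have "\<epsilon> ^ 3 / 256 = (\<epsilon> / 4 * n) * (\<epsilon> / 8)\<^sup>2 / n"
      using n by (simp add: power2_eq_square power3_eq_cube)
    also have "\<dots> \<le> card J' * (\<epsilon> / 8)\<^sup>2 / n"
      using J'_large by (intro divide_right_mono mult_right_mono) auto
    finally show ?thesis .
  qed
  moreover have "\<kappa> + 2 * (\<epsilon> / 8) = \<beta> - \<epsilon> / 4" by (simp add: \<kappa>_def)
  ultimately show ?thesis by linarith
qed

lemma exit_height_le:
  assumes n: "n \<ge> 1" and top: "\<And>i. i < n \<Longrightarrow> (i, n) \<in> A"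
  shows "(\<Sum>i<n. (step_avg n A ^^ T) (height n \<circ> snd) (i, 0)) / n \<le> card (cyl n - A) / (real n)\<^sup>2"
  \<comment> \<open>With no rows and \<kappa> = \<delta> = 0 the first alternative is 0, which the
    second dominates.\<close>
  using exit_height_bound[OF n top, of "{}" 0 0 T] by simp

text \<open>Reflection turns the depth of a walk from the top into the height of a walk from the
  bottom, so the bounds for blue transfer to red.\<close>

lemma exit_depth_le_refl:
  "(\<Sum>i<n. (step_avg n A ^^ T) (\<lambda>v. 1 - height n (snd v)) (i, n)) / n
    \<le> (\<Sum>i<n. (step_avg n {v. refl_height n v \<in> A} ^^ T) (height n \<circ> snd) (i, 0)) / n"
proof (intro divide_right_mono sum_mono)
  fix i assume "i \<in> {..<n}"
  then have i: "(i, 0) \<in> cyl n" by (auto simp: cyl_def)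
  have "(step_avg n A ^^ T) (\<lambda>v. 1 - height n (snd v)) (i, n)
      = (step_avg n {v. refl_height n v \<in> A} ^^ T) (\<lambda>v. 1 - height n (snd (refl_height n v))) (i, 0)"
    by (subst funpow_step_avg_refl_height[OF i]) (simp add: refl_height_def)
  also have "\<dots> \<le> (step_avg n {v. refl_height n v \<in> A} ^^ T) (height n \<circ> snd) (i, 0)"
    by (rule funpow_step_avg_mono[OF _ i])
      (auto simp: cyl_def height_def refl_height_def of_nat_diff diff_divide_distrib)
  finally show "(step_avg n A ^^ T) (\<lambda>v. 1 - height n (snd v)) (i, n)
    \<le> (step_avg n {v. refl_height n v \<in> A} ^^ T) (height n \<circ> snd) (i, 0)" .
qed simp

lemma card_refl_height_le: "card (cyl n - {v. refl_height n v \<in> A}) \<le> card (cyl n - A)"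
  by (rule card_inj_on_le[of "refl_height n"])
    (auto intro!: inj_on_inverseI[of _ "refl_height n"])

lemma exit_depth_le:
  assumes n: "n \<ge> 1" and bottom: "\<And>i. i < n \<Longrightarrow> (i, 0) \<in> A"
  shows "(\<Sum>i<n. (step_avg n A ^^ T) (\<lambda>v. 1 - height n (snd v)) (i, n)) / n
    \<le> card (cyl n - A) / (real n)\<^sup>2"
proof -
  have "card (cyl n - {v. refl_height n v \<in> A}) / (real n)\<^sup>2 \<le> card (cyl n - A) / (real n)\<^sup>2"
    using card_refl_height_le by (intro divide_right_mono) auto
  moreover have "(i, n) \<in> {v. refl_height n v \<in> A}" if "i < n" for i
    using bottom[OF that] by (simp add: refl_height_def)
  ultimately show ?thesis
    using exit_depth_le_refl exit_height_le[OF n, of "{v. refl_height n v \<in> A}" T] order_trans by meson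
qed

lemma exit_depth_gain:
  fixes \<beta> \<epsilon> :: real
  assumes n: "n \<ge> 1" and bottom: "\<And>i. i < n \<Longrightarrow> (i, 0) \<in> A"
    and J: "J \<subseteq> {..n}" "\<And>j. j \<in> J \<Longrightarrow> \<exists>i<n. (i, j) \<in> A" "\<And>j. j \<in> J \<Longrightarrow> real n - real j \<le> \<beta> * n"
    and \<epsilon>: "\<epsilon> > 0" and large: "card J > \<epsilon> * n" "\<epsilon> * n \<ge> 4"
  shows "(\<Sum>i<n. (step_avg n A ^^ T) (\<lambda>v. 1 - height n (snd v)) (i, n)) / n
    \<le> max (\<beta> - \<epsilon> / 4) (card (cyl n - A) / (real n)\<^sup>2 - \<epsilon> ^ 3 / 256)"
proof -
  have inj: "inj_on (\<lambda>j. n - j) J" using J(1) by (intro inj_onI) (metis atMost_iff diff_diff_cancel subsetD)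
  have "(\<Sum>i<n. (step_avg n {v. refl_height n v \<in> A} ^^ T) (height n \<circ> snd) (i, 0)) / n
    \<le> max (\<beta> - \<epsilon> / 4) (card (cyl n - {v. refl_height n v \<in> A}) / (real n)\<^sup>2 - \<epsilon> ^ 3 / 256)"
  proof (rule exit_height_gain[OF n, where J = "(\<lambda>j. n - j) ` J"])
    show "(i, n) \<in> {v. refl_height n v \<in> A}" if "i < n" for i
      using bottom[OF that] by (simp add: refl_height_def)
    show "\<exists>i<n. (i, j) \<in> {v. refl_height n v \<in> A}" if j: "j \<in> (\<lambda>j. n - j) ` J" for j
    proof -
      obtain k where k: "j = n - k" "k \<in> J" using j by auto
      then show ?thesis using J(1,2) by (force simp: refl_height_def)
    qed
    show "real j \<le> \<beta> * n" if j: "j \<in> (\<lambda>j. n - j) ` J" for j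
    proof -
      obtain k where k: "j = n - k" "k \<in> J" using j by auto
      moreover have "k \<le> n" using k J(1) by auto
      ultimately show ?thesis using J(3)[of k] by (simp add: of_nat_diff)
    qed
  qed (use \<epsilon> large in \<open>auto simp: card_image[OF inj]\<close>)
  moreover have "card (cyl n - {v. refl_height n v \<in> A}) / (real n)\<^sup>2 \<le> card (cyl n - A) / (real n)\<^sup>2"
    using card_refl_height_le by (intro divide_right_mono) auto
  ultimately show ?thesis using exit_depth_le_refl[of T n A] by linarith
qed

text \<open>The baseline bounds b and r for the two walks add up to 1 + 1/n and alone give drift at
  least -1/n. Outside \<open>Omega_eps\<close> one of the two improves, either by \<epsilon>^3/256
  or to \<epsilon>/4 below \<alpha> or 1 - \<alpha>; rounding costs at most 2/n.\<close>

lemma expected_drift_outside: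
  fixes \<alpha> \<epsilon> :: real
  assumes \<alpha>: "0 < \<alpha>" "\<alpha> < 1" and \<epsilon>: "\<epsilon> > 0"
    and n: "n \<ge> 1" "\<epsilon> * n \<ge> 4" and \<sigma>: "\<sigma> \<in> Omega \<alpha> n - Omega_eps \<alpha> \<epsilon> n"
  shows "(\<integral>\<omega>. h n (erosion n \<sigma> 1 \<omega>) - h n (erosion n \<sigma> 0 \<omega>) \<partial>erosion_space n)
    \<ge> min (\<epsilon> / 4) (\<epsilon> ^ 3 / 256) - 2 / n"
proof -
  define B R where "B = coloured n \<sigma> Blue" and "R = coloured n \<sigma> Red"
  define b r where "b = card B / (real n)\<^sup>2" and "r = card R / (real n)\<^sup>2"
  define JB where "JB = {j \<in> {..n}. height n j \<le> \<alpha> \<and> (\<exists>i<n. \<sigma> (i, j) = Red)}"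
  define JR where "JR = {j \<in> {..n}. height n j \<ge> \<alpha> \<and> (\<exists>i<n. \<sigma> (i, j) = Blue)}"
  have "\<sigma> v = Blue \<or> \<sigma> v = Red" for v by (cases "\<sigma> v") auto
  then have "cyl n = B \<union> R"
    unfolding B_def R_def coloured_def by blast
  moreover have "B \<inter> R = {}"
    unfolding B_def R_def coloured_def by force
  ultimately have cyl: "cyl n = B \<union> R" "B \<inter> R = {}" .
  have "finite B" "finite R" by (simp_all add: B_def R_def)
  then have "card (cyl n) = card B + card R"
    unfolding cyl(1) by (rule card_Un_disjoint[OF _ _ cyl(2)])
  then have "card B + card R = n * (n + 1)" by (simp add: cyl_def)
  then have "real (card B + card R) = real (n * (n + 1))" by (simp only:)
  then have BR: "real (card B) + card R = real n * (real n + 1)" by (simp add: algebra_simps)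
  have cardB: "int (card B) = \<lfloor>\<alpha> * real n * (real n + 1)\<rfloor>"
    using \<sigma> by (simp add: Omega_def B_def)
  then have B1: "card B \<le> \<alpha> * (real n * (real n + 1))"
    and B2: "card B \<ge> \<alpha> * (real n * (real n + 1)) - 1"
    unfolding mult.assoc[symmetric] by linarith+
  have nn: "real n * (real n + 1) > 0" using n by simp
  have "real (card B) < 1 * (real n * (real n + 1))"
    using B1 mult_strict_right_mono[OF \<alpha>(2) nn] by linarith
  then have R_ne: "coloured n \<sigma> Red \<noteq> {}"
    using BR by (auto simp: R_def[symmetric])
  have br: "b + r = 1 + 1 / n"
    using BR n by (simp add: b_def r_def power2_eq_square add_divide_distrib[symmetric]) (simp add: field_simps)
  have b_le: "b \<le> \<alpha> + 1 / n"
  proof -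
    have "b \<le> \<alpha> * (real n * (real n + 1)) / (real n)\<^sup>2"
      unfolding b_def by (intro divide_right_mono B1) simp
    also have "\<dots> = \<alpha> + \<alpha> / n" using n by (simp add: power2_eq_square field_simps)
    also have "\<alpha> / n \<le> 1 / n" using \<alpha> by (intro divide_right_mono) auto
    finally show ?thesis by simp
  qed
  \<comment> \<open>The floor in the number of blue vertices costs 1/n^2 \<le> 1/n, on top of the
    surplus 1/n in b + r.\<close>
  have r_le: "r \<le> 1 - \<alpha> + 2 / n"
  proof -
    have "b \<ge> (\<alpha> * (real n * (real n + 1)) - 1) / (real n)\<^sup>2"
      unfolding b_def by (intro divide_right_mono B2) simp
    moreover have "(\<alpha> * (real n * (real n + 1)) - 1) / (real n)\<^sup>2 = \<alpha> + \<alpha> / n - 1 / (real n)\<^sup>2"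
      using n by (simp add: power2_eq_square field_simps)
    moreover have "1 / (real n)\<^sup>2 \<le> 1 / n"
      using n by (simp add: power2_eq_square divide_le_cancel field_simps)
    moreover have "\<alpha> / n \<ge> 0" using \<alpha> by simp
    ultimately have "b \<ge> \<alpha> - 1 / n" by linarith
    then show ?thesis using br by (simp add: field_simps)
  qed
  \<comment> \<open>The red walk runs after z has turned blue. This only enlarges its absorbing set,
    so the bound by r holds uniformly in z.\<close>
  let ?AB = "R \<union> {..<n} \<times> {n}" and ?AR = "\<lambda>z. coloured n (\<sigma>(z := Blue)) Blue \<union> {..<n} \<times> {0}"
  have "cyl n - ?AB \<subseteq> B" using cyl by auto
  then have cB: "card (cyl n - ?AB) / (real n)\<^sup>2 \<le> b"
    unfolding b_def by (intro divide_right_mono of_nat_mono card_mono) (auto simp: B_def)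
  have cR: "card (cyl n - ?AR z) / (real n)\<^sup>2 \<le> r" for z
  proof -
    have "cyl n - ?AR z \<subseteq> R" using cyl(1) by (auto simp: B_def coloured_def)
    then show ?thesis
      unfolding r_def by (intro divide_right_mono of_nat_mono card_mono) (auto simp: R_def)
  qed
  have drift: "(\<integral>\<omega>. h n (erosion n \<sigma> 1 \<omega>) - h n (erosion n \<sigma> 0 \<omega>) \<partial>erosion_space n) \<ge> 1 - M - M'"
    if "\<And>T. (\<Sum>i<n. (step_avg n ?AB ^^ T) (height n \<circ> snd) (i, 0)) / n \<le> M"
      and "\<And>z T. (\<Sum>i<n. (step_avg n (?AR z) ^^ T) (\<lambda>v. 1 - height n (snd v)) (i, n)) / n \<le> M'"
    for M M'
    by (intro expected_drift expected_blue_gain expected_red_loss) (use n R_ne that R_def in auto)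
  have MB: "(\<Sum>i<n. (step_avg n ?AB ^^ T) (height n \<circ> snd) (i, 0)) / n \<le> b" for T
    using exit_height_le[of n ?AB T] n cB by force
  have MR: "(\<Sum>i<n. (step_avg n (?AR z) ^^ T) (\<lambda>v. 1 - height n (snd v)) (i, n)) / n \<le> r" for z T
    using exit_depth_le[of n "?AR z" T] n cR[of z] by force
  have "card JB > \<epsilon> * n \<or> card JR > \<epsilon> * n"
    using \<sigma> by (auto simp: Omega_eps_def JB_def JR_def)
  then show ?thesis
  proof
    assume JB: "card JB > \<epsilon> * n"
    have gain: "(\<Sum>i<n. (step_avg n ?AB ^^ T) (height n \<circ> snd) (i, 0)) / n
        \<le> max (\<alpha> - \<epsilon> / 4) (card (cyl n - ?AB) / (real n)\<^sup>2 - \<epsilon> ^ 3 / 256)" for T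
    proof (rule exit_height_gain[where J = JB])
      show "\<exists>i<n. (i, j) \<in> ?AB" if "j \<in> JB" for j
        using that by (auto simp: JB_def R_def coloured_def cyl_def)
      show "real j \<le> \<alpha> * n" if "j \<in> JB" for j
        using that n by (auto simp: JB_def height_def divide_le_eq)
    qed (use n \<epsilon> JB in \<open>auto simp: JB_def\<close>)
    have "(\<integral>\<omega>. h n (erosion n \<sigma> 1 \<omega>) - h n (erosion n \<sigma> 0 \<omega>) \<partial>erosion_space n)
        \<ge> 1 - max (\<alpha> - \<epsilon> / 4) (b - \<epsilon> ^ 3 / 256) - r"
      by (rule drift[OF _ MR], rule order_trans[OF gain], rule max.mono[OF order_refl diff_right_mono[OF cB]])
    moreover have "1 / real n \<le> 2 / n" by (intro divide_right_mono) auto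
    ultimately show ?thesis using r_le br by (simp add: min_def max_def split: if_splits)
  next
    assume JR: "card JR > \<epsilon> * n"
    have gain: "(\<Sum>i<n. (step_avg n (?AR z) ^^ T) (\<lambda>v. 1 - height n (snd v)) (i, n)) / n
        \<le> max (1 - \<alpha> - \<epsilon> / 4) (card (cyl n - ?AR z) / (real n)\<^sup>2 - \<epsilon> ^ 3 / 256)" for z T
    proof (rule exit_depth_gain[where J = JR])
      show "\<exists>i<n. (i, j) \<in> ?AR z" if "j \<in> JR" for j
        using that by (auto simp: JR_def coloured_def cyl_def)
      show "real n - real j \<le> (1 - \<alpha>) * n" if "j \<in> JR" for j
        using that n by (auto simp: JR_def height_def le_divide_eq algebra_simps)
    qed (use n \<epsilon> JR in \<open>auto simp: JR_def\<close>)
    have "(\<integral>\<omega>. h n (erosion n \<sigma> 1 \<omega>) - h n (erosion n \<sigma> 0 \<omega>) \<partial>erosion_space n)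
        \<ge> 1 - b - max (1 - \<alpha> - \<epsilon> / 4) (r - \<epsilon> ^ 3 / 256)"
      by (rule drift[OF MB], rule order_trans[OF gain], rule max.mono[OF order_refl diff_right_mono[OF cR]])
    moreover have "1 / real n \<le> 2 / n" by (intro divide_right_mono) auto
    ultimately show ?thesis using b_le br by (simp add: min_def max_def split: if_splits)
  qed
qed

theorem theorem5:
  fixes \<alpha> \<epsilon> :: real
  assumes "0 < \<alpha>" and "\<alpha> < 1" and "\<epsilon> > 0"
  shows "\<exists>a>0. \<forall>\<^sub>F n in sequentially. \<forall>\<sigma> \<in> Omega \<alpha> n - Omega_eps \<alpha> \<epsilon> n.
           (\<integral>\<omega>. h n (erosion n \<sigma> 1 \<omega>) - h n (erosion n \<sigma> 0 \<omega>) \<partial>erosion_space n) \<ge> a"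
proof -
  \<comment> \<open>Half of the gain absorbs the error 2/n once n \<ge> 2/a.\<close>
  define a where "a = min (\<epsilon> / 4) (\<epsilon> ^ 3 / 256) / 2"
  have a: "a > 0" using assms by (simp add: a_def)
  have "\<forall>\<^sub>F n in sequentially. real n \<ge> max (4 / \<epsilon>) (max 1 (2 / a))"
    by (rule eventually_compose_filterlim[OF eventually_ge_at_top filterlim_real_sequentially])
  then have "\<forall>\<^sub>F n in sequentially. \<forall>\<sigma> \<in> Omega \<alpha> n - Omega_eps \<alpha> \<epsilon> n.
           (\<integral>\<omega>. h n (erosion n \<sigma> 1 \<omega>) - h n (erosion n \<sigma> 0 \<omega>) \<partial>erosion_space n) \<ge> a"
  proof eventually_elim
    case (elim n)
    then have n: "n \<ge> 1" "\<epsilon> * n \<ge> 4" "a * n \<ge> 2"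
      using assms a by (auto simp: divide_le_eq mult.commute)
    then have "2 / n \<le> a" by (simp add: divide_le_eq)
    then show ?case
      using expected_drift_outside[OF assms n(1,2)] unfolding a_def by fastforce
  qed
  with a show ?thesis by blast
qed

end
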